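(* There is a randomized distributed algorithm that, given an $n$-vertex graph $G$ of constant diameter $D=O(1)$ and an integer $\lambda$, with high probability solves the problem of $O(\log n)$-approximate verification of $\lambda$-edge connectivity in $G$ in $\mathrm{poly}(\lambda\cdot\log n)$ rounds.
   Context: Distributed algorithms are in the standard CONGEST model: the input graph $G$ (unweighted, simple) is the communication network; each node has a processor with a unique ID of $O(\log n)$ bits; execution proceeds in synchronous rounds, and in every round each node can send a message of $O(\log n)$ bits to each of its neighbors. "With high probability" means with probability at least $1-1/n^c$ for some constant $c$. The problem of $O(\log n)$-approximate verification of $\lambda$-edge connectivity: given $G$ and $\lambda$, if $G$ is $\lambda$-edge connected then all nodes must output YES, and if the edge connectivity of $G$ is at most $\lambda/\log n$ then all nodes must output NO (no requirement otherwise). *)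

theory Defs
  imports
    "HOL-Probability.Probability"
    "HOL-Computational_Algebra.Polynomial"
    "Graph_Theory.Graph_Theory"
begin

section \<open>Edge connectivity and diameter\<close>

text \<open>
  A finite simple undirected graph is a \<open>pair_graph\<close>: a finite, loop-free, symmetric set of pairs.
  The two arcs \<open>(u, v)\<close> and \<open>(v, u)\<close> form one undirected edge, so edges are counted as the
  two-element sets \<open>{u, v}\<close>, and deleting an edge deletes both arcs.
\<close>

definition uedges :: "'a pair_pre_digraph \<Rightarrow> 'a set set" where
  "uedges G = {{u, v} | u v. (u, v) \<in> parcs G}"

definition delete_uedges :: "'a pair_pre_digraph \<Rightarrow> 'a set set \<Rightarrow> 'a pair_pre_digraph" where
  "delete_uedges G F = \<lparr>pverts = pverts G, parcs = {(u, v) \<in> parcs G. {u, v} \<notin> F}\<rparr>"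

definition edge_connected :: "nat \<Rightarrow> 'a pair_pre_digraph \<Rightarrow> bool" where
  "edge_connected k G \<longleftrightarrow>
     card (pverts G) \<ge> 2 \<and>
     (\<forall>F. F \<subseteq> uedges G \<and> card F < k \<longrightarrow>
        Digraph_Component.connected (with_proj (delete_uedges G F)))"

text \<open>Only meaningful for graphs with at least two vertices, where a disconnecting edge set exists.\<close>

definition edge_connectivity :: "'a pair_pre_digraph \<Rightarrow> nat" where
  "edge_connectivity G =
     (LEAST k. \<exists>F. F \<subseteq> uedges G \<and> card F = k \<and>
        \<not> Digraph_Component.connected (with_proj (delete_uedges G F)))"

text \<open>The largest hop distance; it is \<open>\<infinity>\<close> for a disconnected graph.\<close>

definition graph_diameter :: "'a pair_pre_digraph \<Rightarrow> ereal" where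
  "graph_diameter G =
     (SUP (u, v) \<in> pverts G \<times> pverts G. wf_digraph.\<mu> (with_proj G) (\<lambda>_. 1) u v)"


section \<open>Randomized algorithms in the CONGEST model\<close>

text \<open>
  Vertices are natural numbers, and a vertex is its own identifier. A node addresses its neighbours
  through local ports: port \<open>i\<close> of \<open>v\<close> leads to \<open>P v ! i\<close>. Initially a node knows the number of
  vertices, the parameter \<open>\<lambda>\<close>, its own identifier, its degree and its private random bits, but
  neither the identifiers of its neighbours nor anything else about the graph.
\<close>

type_synonym msg = "bool list"

record node_input =
  num_nodes :: nat
  param :: nat
  ident :: nat
  num_ports :: nat
  coins :: "bool list"

text \<open>
  The state of a node is its entire local view: its input, and for every completed round the list
  of messages received, indexed by port. Every local state is a function of this view, so an
  algorithm is given by functions of the view; local computation is unrestricted.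
  \<open>send A I H i\<close> is the message sent through port \<open>i\<close> in the next round (the empty message being
  silence); \<open>verdict A I H\<close> is \<open>None\<close> while the node is undecided, and \<open>True\<close> stands for YES.
  \<open>num_coins A n l\<close> is the number of private random bits given to each node.
\<close>

record congest_algorithm =
  num_coins :: "nat \<Rightarrow> nat \<Rightarrow> nat"
  send :: "node_input \<Rightarrow> msg list list \<Rightarrow> nat \<Rightarrow> msg"
  verdict :: "node_input \<Rightarrow> msg list list \<Rightarrow> bool option"

definition congest_bandwidth :: "congest_algorithm \<Rightarrow> nat \<Rightarrow> bool" where
  "congest_bandwidth A B \<longleftrightarrow>
     (\<forall>I H i. real (length (send A I H i)) \<le> real B * log 2 (real (num_nodes I)))"

definition port_numbering :: "nat pair_pre_digraph \<Rightarrow> (nat \<Rightarrow> nat list) \<Rightarrow> bool" where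
  "port_numbering G P \<longleftrightarrow>
     (\<forall>v \<in> pverts G. distinct (P v) \<and> set (P v) = {u. (v, u) \<in> parcs G})"

definition port_to :: "(nat \<Rightarrow> nat list) \<Rightarrow> nat \<Rightarrow> nat \<Rightarrow> nat" where
  "port_to P u v = (THE i. i < length (P u) \<and> P u ! i = v)"

definition input_of ::
  "nat pair_pre_digraph \<Rightarrow> (nat \<Rightarrow> nat list) \<Rightarrow> nat \<Rightarrow> (nat \<Rightarrow> bool list) \<Rightarrow> nat \<Rightarrow> node_input" where
  "input_of G P l \<omega> v =
     \<lparr>num_nodes = card (pverts G), param = l, ident = v, num_ports = length (P v), coins = \<omega> v\<rparr>"

text \<open>\<open>history A G P l \<omega> t v\<close> is what \<open>v\<close> has received in the first \<open>t\<close> rounds.\<close>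

primrec history ::
  "congest_algorithm \<Rightarrow> nat pair_pre_digraph \<Rightarrow> (nat \<Rightarrow> nat list) \<Rightarrow> nat \<Rightarrow> (nat \<Rightarrow> bool list)
     \<Rightarrow> nat \<Rightarrow> nat \<Rightarrow> msg list list" where
  "history A G P l \<omega> 0 = (\<lambda>v. [])"
| "history A G P l \<omega> (Suc t) = (\<lambda>v. history A G P l \<omega> t v @
     [map (\<lambda>u. send A (input_of G P l \<omega> u) (history A G P l \<omega> t u) (port_to P u v)) (P v)])"

text \<open>Outputs are irrevocable: the first one counts.\<close>

definition outputs_by ::
  "congest_algorithm \<Rightarrow> nat pair_pre_digraph \<Rightarrow> (nat \<Rightarrow> nat list) \<Rightarrow> nat \<Rightarrow> (nat \<Rightarrow> bool list)
     \<Rightarrow> nat \<Rightarrow> nat \<Rightarrow> bool \<Rightarrow> bool" where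
  "outputs_by A G P l \<omega> T v b \<longleftrightarrow>
     (\<exists>t \<le> T. verdict A (input_of G P l \<omega> v) (history A G P l \<omega> t v) = Some b \<and>
        (\<forall>s < t. verdict A (input_of G P l \<omega> v) (history A G P l \<omega> s v) = None))"

text \<open>Independent, uniformly random bit strings, one for each node.\<close>

definition coin_pmf :: "congest_algorithm \<Rightarrow> nat pair_pre_digraph \<Rightarrow> nat \<Rightarrow> (nat \<Rightarrow> bool list) pmf" where
  "coin_pmf A G l = Pi_pmf (pverts G) []
     (\<lambda>_. pmf_of_set {bs. length bs = num_coins A (card (pverts G)) l})"


section \<open>Approximate verification of edge connectivity\<close>

text \<open>
  All nodes must produce an output within \<open>T\<close> rounds; the outputs are unconstrained if the edge
  connectivity lies strictly between \<open>\<lambda> / log n\<close> and \<open>\<lambda>\<close>.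
\<close>

definition verifies_edge_connectivity ::
  "congest_algorithm \<Rightarrow> nat pair_pre_digraph \<Rightarrow> (nat \<Rightarrow> nat list) \<Rightarrow> nat \<Rightarrow> (nat \<Rightarrow> bool list)
     \<Rightarrow> nat \<Rightarrow> bool" where
  "verifies_edge_connectivity A G P l \<omega> T \<longleftrightarrow>
     (\<forall>v \<in> pverts G. \<exists>b. outputs_by A G P l \<omega> T v b) \<and>
     (edge_connected l G \<longrightarrow> (\<forall>v \<in> pverts G. outputs_by A G P l \<omega> T v True)) \<and>
     (real (edge_connectivity G) \<le> real l / log 2 (real (card (pverts G))) \<longrightarrow>
        (\<forall>v \<in> pverts G. outputs_by A G P l \<omega> T v False))"

end

theory Submission
  imports Defs
begin

text \<open>
  Following Chuzhoy, Parter and Tan, keep every edge independently with probability about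
  \<open>log n / \<lambda>\<close>. A cut of at most \<open>\<lambda> / log n\<close> edges loses all of them with constant probability, so
  that one of \<open>O(log n)\<close> independent trials is disconnected with high probability. If the graph is
  \<open>\<lambda>\<close>-edge connected, on the other hand, every sample has diameter \<open>(\<lambda> log n)\<^bsup>O(D)\<^esup>\<close> with high
  probability, so that connectivity of the samples can be tested by flooding.

  For the diameter bound, the edges are sampled in \<open>O(log n)\<close> levels of probability about \<open>1 / \<lambda>\<close>.
  Each level merges a constant fraction of the components in expectation (Boruvka), so all levels
  but one already give a connected graph \<open>H\<close>. The remaining level samples the edges of a
  breadth-first search tree of depth \<open>D\<close>: among any \<open>O(\<lambda> log n)\<close> vertices of depth \<open>k\<close> some vertex
  keeps its parent edge, hence every vertex reaches depth less than \<open>k\<close> by a walk of that length,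
  and the claim follows by contracting the deepest layer and induction on the depth.

  The constants are good enough only for large \<open>n\<close>; below a constant threshold every node collects
  the whole graph.
\<close>

section \<open>Random subsets of a finite set\<close>

text \<open>Independence is what has to be protected. The tree edges must be sampled independently
  of the connected graph whose walks they shorten, hence the level reserved for them. The graph left
  after contracting the deepest layer depends on that layer's coins, so the induction runs over
  arbitrary connected graphs and only the coins of shallower layers stay random.

  The same coins have to serve both promises. Under high connectivity all trials must succeed, while
  a small cut needs just one trial that misses it, so the failure probability of a trial must beat
  the number of trials. Fair bits only yield probabilities \<open>1 / 2 ^ m\<close>; choosing
  \<open>2 ^ m\<close> at most \<lambda> but more than half of it serves both directions. Each
  endpoint of an edge has its own coins and the edge is kept if either says so, which avoids
  agreeing on a common coin and only doubles the coins of a cut. Probabilities are finite weighted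
  sums over subsets until they are read off the bit strings.\<close>

definition expect :: "real \<Rightarrow> 'a set \<Rightarrow> ('a set \<Rightarrow> real) \<Rightarrow> real" where
  "expect p I g = (\<Sum>S\<in>Pow I. p ^ card S * (1 - p) ^ card (I - S) * g S)"

lemma expect_empty [simp]: "expect p {} g = g {}"
  by (simp add: expect_def)

lemma expect_insert:
  assumes "finite I" "x \<notin> I"
  shows "expect p (insert x I) g = (1 - p) * expect p I g + p * expect p I (\<lambda>S. g (insert x S))"
proof -
  let ?w = "\<lambda>I S. p ^ card S * (1 - p) ^ card (I - S)"
  have inj: "inj_on (insert x) (Pow I)"
    using assms(2) by (auto simp: inj_on_def)
  have "expect p (insert x I) g =
      (\<Sum>S\<in>Pow I. ?w (insert x I) S * g S) + (\<Sum>S\<in>insert x ` Pow I. ?w (insert x I) S * g S)"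
    unfolding expect_def Pow_insert using assms by (intro sum.union_disjoint) auto
  also have "(\<Sum>S\<in>insert x ` Pow I. ?w (insert x I) S * g S) =
      (\<Sum>S\<in>Pow I. ?w (insert x I) (insert x S) * g (insert x S))"
    by (simp add: sum.reindex[OF inj])
  also have "\<dots> = (\<Sum>S\<in>Pow I. p * (?w I S * g (insert x S)))"
  proof (intro sum.cong refl)
    fix S assume S: "S \<in> Pow I"
    then have "finite S" "x \<notin> S" "insert x I - insert x S = I - S"
      using assms finite_subset by auto
    then show "?w (insert x I) (insert x S) * g (insert x S) = p * (?w I S * g (insert x S))" by simp
  qed
  also have "(\<Sum>S\<in>Pow I. ?w (insert x I) S * g S) = (\<Sum>S\<in>Pow I. (1 - p) * (?w I S * g S))"
  proof (intro sum.cong refl)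
    fix S assume S: "S \<in> Pow I"
    then have "insert x I - S = insert x (I - S)" "finite (I - S)" "x \<notin> I - S"
      using assms by auto
    then show "?w (insert x I) S * g S = (1 - p) * (?w I S * g S)" by simp
  qed
  finally show ?thesis by (simp add: expect_def sum_distrib_left)
qed

lemma expect_cong: "(\<And>S. S \<subseteq> I \<Longrightarrow> f S = g S) \<Longrightarrow> expect p I f = expect p I g"
  unfolding expect_def by (intro sum.cong) auto

lemma expect_mono:
  assumes "0 \<le> p" "p \<le> 1" "\<And>S. S \<subseteq> I \<Longrightarrow> f S \<le> g S"
  shows "expect p I f \<le> expect p I g"
  unfolding expect_def using assms by (intro sum_mono mult_left_mono) auto

lemma expect_add: "expect p I (\<lambda>S. f S + g S) = expect p I f + expect p I g"
  by (simp add: expect_def sum.distrib distrib_left)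

lemma expect_cmult: "expect p I (\<lambda>S. c * f S) = c * expect p I f"
  by (simp add: expect_def sum_distrib_left mult_ac)

lemma expect_const [simp]: "finite I \<Longrightarrow> expect p I (\<lambda>_. c) = c"
  by (induction rule: finite_induct) (simp_all add: expect_insert algebra_simps)

lemma expect_diff: "expect p I (\<lambda>S. f S - g S) = expect p I f - expect p I g"
  by (simp add: expect_def sum_subtractf right_diff_distrib)

lemma expect_sum: "expect p I (\<lambda>S. \<Sum>a\<in>A. f a S) = (\<Sum>a\<in>A. expect p I (f a))"
  by (simp add: expect_def sum_distrib_left sum.swap[of _ A])

lemma expect_Un:
  assumes "finite I" "finite J" "I \<inter> J = {}"
  shows "expect p (I \<union> J) g = expect p I (\<lambda>S. expect p J (\<lambda>T. g (S \<union> T)))"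
  using assms
proof (induction I arbitrary: g rule: finite_induct)
  case (insert x I)
  then show ?case by (simp add: expect_insert)
qed simp

lemma expect_marginal:
  assumes "finite I" "J \<subseteq> I"
  shows "expect p I (\<lambda>S. g (S \<inter> J)) = expect p J g"
proof -
  have *: "I = (I - J) \<union> J" using assms by auto
  have "expect p ((I - J) \<union> J) (\<lambda>S. g (S \<inter> J)) =
      expect p (I - J) (\<lambda>S. expect p J (\<lambda>T. g ((S \<union> T) \<inter> J)))"
    using assms by (intro expect_Un) (auto intro: finite_subset)
  also have "\<dots> = expect p (I - J) (\<lambda>S. expect p J g)"
  proof (intro expect_cong)
    fix S T assume "S \<subseteq> I - J" "T \<subseteq> J"
    then have "(S \<union> T) \<inter> J = T" by auto
    then show "g ((S \<union> T) \<inter> J) = g T" by simp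
  qed
  finally show ?thesis using assms * by simp
qed

lemma expect_image:
  assumes "inj_on h I"
  shows "expect p (h ` I) g = expect p I (\<lambda>S. g (h ` S))"
proof -
  have "inj_on ((`) h) (Pow I)" using assms by (rule inj_on_image_Pow)
  moreover have "card (h ` S) = card S" "card (h ` I - h ` S) = card (I - S)" if "S \<subseteq> I" for S
    using assms that inj_on_image_set_diff[OF assms, of I S]
    by (metis Diff_subset card_image inj_on_subset order_refl)+
  ultimately show ?thesis
    unfolding expect_def image_Pow_surj[OF refl, symmetric]
    by (simp add: sum.reindex)
qed

text \<open>Dropping coordinates and renaming the others injectively preserves independence. This
  extracts the tree edges from a level, a single trial from all trials, and the coins of the arcs
  from the coins of the nodes.\<close>

lemma expect_vimage:
  assumes "finite I" "inj_on h J" "h ` J \<subseteq> I"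
  shows "expect p I (\<lambda>S. g {x \<in> J. h x \<in> S}) = expect p J g"
proof -
  have "expect p I (\<lambda>S. g {x \<in> J. h x \<in> S}) = expect p I (\<lambda>S. g {x \<in> J. h x \<in> S \<inter> h ` J})"
    by (intro expect_cong arg_cong[of _ _ g]) auto
  also have "\<dots> = expect p (h ` J) (\<lambda>S. g {x \<in> J. h x \<in> S})"
    using assms by (intro expect_marginal[where g = "\<lambda>S. g {x \<in> J. h x \<in> S}"]) auto
  also have "\<dots> = expect p J (\<lambda>S. g {x \<in> J. h x \<in> h ` S})"
    by (rule expect_image) fact
  also have "\<dots> = expect p J g"
  proof (intro expect_cong)
    fix S assume "S \<subseteq> J"
    then have "{x \<in> J. h x \<in> h ` S} = S" using assms(2) by (auto dest: inj_onD)
    then show "g {x \<in> J. h x \<in> h ` S} = g S" by simp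
  qed
  finally show ?thesis .
qed

lemma expect_avoid:
  assumes "finite I" "F \<subseteq> I"
  shows "expect p I (\<lambda>S. of_bool (S \<inter> F = {})) = (1 - p) ^ card F"
proof -
  have "expect p I (\<lambda>S. of_bool (S \<inter> F = {})) = expect p F (\<lambda>S. of_bool (S = {}))"
    using expect_marginal[OF assms, of p "\<lambda>S. of_bool (S = {})"] by simp
  also have "\<dots> = (\<Sum>S\<in>Pow F. if S = {} then (1 - p) ^ card F else 0)"
    unfolding expect_def by (intro sum.cong) auto
  also have "\<dots> = (1 - p) ^ card F"
    using assms by (simp add: sum.delta finite_subset)
  finally show ?thesis .
qed

lemma expect_le:
  assumes "finite I" "0 \<le> p" "p \<le> 1" "\<And>S. S \<subseteq> I \<Longrightarrow> g S \<le> c"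
  shows "expect p I g \<le> c"
  using expect_mono[of p I g "\<lambda>_. c"] assms by simp

section \<open>Components of a union of random edge sets\<close>

text \<open>A sampled arc may lack its reverse, hence the symmetric closure.\<close>

definition comps :: "'a set \<Rightarrow> 'a rel \<Rightarrow> 'a set set" where
  "comps V A = (\<lambda>v. (A \<union> A\<inverse>)\<^sup>* `` {v}) ` V"

text \<open>Double counting: elements of \<open>G\<close> weigh 1, all others 2. Every fibre of
  \<open>f\<close> weighs at least 2, because an element of \<open>G\<close> shares its fibre with a
  partner, and the total weight is \<open>2 * card X - card G\<close>.\<close>

lemma card_image_partners:
  assumes "finite X" "G \<subseteq> X" "\<And>x. x \<in> G \<Longrightarrow> \<exists>x'\<in>X. x' \<noteq> x \<and> f x' = f x"
  shows "2 * real (card (f ` X)) + real (card G) \<le> 2 * real (card X)"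
proof -
  have fin: "finite (f ` X)" using assms by simp
  have "2 * real (card (f ` X)) = (\<Sum>y\<in>f ` X. 2)" by simp
  also have "\<dots> \<le> (\<Sum>y\<in>f ` X. \<Sum>x\<in>{x\<in>X. f x = y}. 2 - of_bool (x \<in> G))"
  proof (intro sum_mono)
    fix y assume "y \<in> f ` X"
    then obtain x where x: "x \<in> X" "f x = y" by auto
    show "(2::real) \<le> (\<Sum>x\<in>{x\<in>X. f x = y}. 2 - of_bool (x \<in> G))"
    proof (cases "x \<in> G")
      case True
      then obtain x' where x': "x' \<in> X" "x' \<noteq> x" "f x' = y" using assms(3) x by metis
      have "(2::real) \<le> (\<Sum>x\<in>{x, x'}. 2 - of_bool (x \<in> G))"
        using x' by (simp add: of_bool_def)
      also have "\<dots> \<le> (\<Sum>x\<in>{x\<in>X. f x = y}. 2 - of_bool (x \<in> G))"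
        using x x' assms(1) by (intro sum_mono2) (auto simp: of_bool_def)
      finally show ?thesis .
    next
      case False
      then have "(2::real) \<le> (\<Sum>x\<in>{x}. 2 - of_bool (x \<in> G))" by simp
      also have "\<dots> \<le> (\<Sum>x\<in>{x\<in>X. f x = y}. 2 - of_bool (x \<in> G))"
        using x assms(1) by (intro sum_mono2) (auto simp: of_bool_def)
      finally show ?thesis .
    qed
  qed
  also have "\<dots> = (\<Sum>x\<in>X. 2 - of_bool (x \<in> G))"
    by (rule sum.group) (use assms in auto)
  also have "\<dots> = 2 * real (card X) - real (card G)"
    using assms(1,2) by (simp add: sum_subtractf of_bool_def sum.If_cases Int_absorb1)
  finally show ?thesis by simp
qed

lemma rtrancl_sym_Image_cong:
  assumes "sym R" "(x, y) \<in> R\<^sup>*"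
  shows "R\<^sup>* `` {x} = R\<^sup>* `` {y}"
proof -
  have "(y, x) \<in> R\<^sup>*" using assms by (meson sym_rtrancl symD)
  then show ?thesis using assms(2) by (auto intro: rtrancl_trans)
qed

lemma sym_Un_conv: "sym (A \<union> A\<inverse>)"
  by (auto intro: symI)

text \<open>The counting behind Boruvka: an arc of \<open>S\<close> leaving an old component puts it
  into the same new component as the old one at the other end, so each such component has a
  partner.\<close>

lemma comps_merge:
  assumes "finite V" "A \<subseteq> V \<times> V" "S \<subseteq> V \<times> V"
  shows "2 * real (card (comps V (A \<union> S))) +
      real (card {C \<in> comps V A. S \<inter> C \<times> (- C) \<noteq> {}}) \<le> 2 * real (card (comps V A))"
proof -
  let ?R = "A \<union> A\<inverse>" and ?R' = "(A \<union> S) \<union> (A \<union> S)\<inverse>"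
  let ?f = "\<lambda>C. ?R'\<^sup>* `` C"
  have sub: "?R\<^sup>* \<subseteq> ?R'\<^sup>*" by (rule rtrancl_mono) auto
  \<comment> \<open>\<open>?f\<close> sends an old component to the new component that contains
    it.\<close>
  have f: "?f (?R\<^sup>* `` {v}) = ?R'\<^sup>* `` {v}" for v
  proof
    show "?f (?R\<^sup>* `` {v}) \<subseteq> ?R'\<^sup>* `` {v}"
      using sub by (auto intro: rtrancl_trans)
  qed auto
  have im: "comps V (A \<union> S) = ?f ` comps V A"
    unfolding comps_def image_image f ..
  show ?thesis unfolding im
  proof (rule card_image_partners)
    show "finite (comps V A)" using assms by (simp add: comps_def)
    fix C assume C: "C \<in> {C \<in> comps V A. S \<inter> C \<times> (- C) \<noteq> {}}"
    then obtain v u w where v: "v \<in> V" "C = ?R\<^sup>* `` {v}" "(u, w) \<in> S" "u \<in> C" "w \<notin> C"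
      by (auto simp: comps_def)
    have "?R\<^sup>* `` {w} \<in> comps V A" using v assms(3) by (auto simp: comps_def)
    moreover have "?R\<^sup>* `` {w} \<noteq> C" using v by auto
    moreover have "?f (?R\<^sup>* `` {w}) = ?f C"
    proof -
      have "(v, u) \<in> ?R'\<^sup>*" using v sub by auto
      moreover have "(u, w) \<in> ?R'" using v by auto
      ultimately have "(v, w) \<in> ?R'\<^sup>*" by (rule rtrancl_into_rtrancl)
      then have "?R'\<^sup>* `` {v} = ?R'\<^sup>* `` {w}"
        by (intro rtrancl_sym_Image_cong) (auto intro: symI)
      then show ?thesis using v f by simp
    qed
    ultimately show "\<exists>C'\<in>comps V A. C' \<noteq> C \<and> ?f C' = ?f C"
      by (intro bexI[of _ "?R\<^sup>* `` {w}"] conjI)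
  qed (rule Collect_restrict)
qed

lemma comps_subset:
  assumes "A \<subseteq> V \<times> V" "C \<in> comps V A"
  shows "C \<subseteq> V" "C \<noteq> {}"
proof -
  obtain v where v: "v \<in> V" "C = (A \<union> A\<inverse>)\<^sup>* `` {v}" using assms by (auto simp: comps_def)
  have "w \<in> V" if "(v, w) \<in> (A \<union> A\<inverse>)\<^sup>*" for w
    using that by (induction rule: rtrancl_induct) (use v assms in auto)
  then show "C \<subseteq> V" using v by auto
  show "C \<noteq> {}" using v by auto
qed

lemma comps_proper:
  assumes "C \<in> comps V A" "card (comps V A) \<ge> 2"
  shows "C \<noteq> V"
proof
  assume "C = V"
  then obtain v where v: "V = (A \<union> A\<inverse>)\<^sup>* `` {v}" using assms by (auto simp: comps_def)
  have "(A \<union> A\<inverse>)\<^sup>* `` {w} = V" if "w \<in> V" for w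
    using rtrancl_sym_Image_cong[OF sym_Un_conv, of v w A] that v by auto
  then have "comps V A \<subseteq> {V}" by (auto simp: comps_def)
  then have "card (comps V A) \<le> card {V}" by (intro card_mono) auto
  then show False using assms by simp
qed

lemma comps_connected:
  assumes "card (comps V A) < 2" "finite V" "u \<in> V" "v \<in> V"
  shows "(u, v) \<in> (A \<union> A\<inverse>)\<^sup>*"
proof -
  have "finite (comps V A)" using assms by (simp add: comps_def)
  moreover have "(A \<union> A\<inverse>)\<^sup>* `` {u} \<in> comps V A" "(A \<union> A\<inverse>)\<^sup>* `` {v} \<in> comps V A"
    using assms by (auto simp: comps_def)
  ultimately have "(A \<union> A\<inverse>)\<^sup>* `` {u} = (A \<union> A\<inverse>)\<^sup>* `` {v}"
    using assms(1) by (metis card_le_Suc0_iff_eq less_2_cases_iff less_Suc_eq_le numeral_2_eq_2)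
  then show ?thesis by auto
qed

text \<open>A single component has no leaving arc, so the plain count would stop shrinking at 1.
  With the value 0 there the expectation contracts all the way, and since every other value is at
  least 2 it bounds the probability of being disconnected.\<close>

definition excess :: "'a set \<Rightarrow> 'a rel \<Rightarrow> real" where
  "excess V A = (if card (comps V A) \<ge> 2 then real (card (comps V A)) else 0)"

text \<open>Each component is left by at least \<open>l\<close> arcs, so a sampled one leaves it
  with probability at least 1/2. Such a component saves half a component by
  \<open>comps_merge\<close>, which gives the factor \<open>1 - 1/2 * 1/2\<close>.\<close>

lemma expect_excess_step:
  assumes "finite V" "E \<subseteq> V \<times> V" "A \<subseteq> V \<times> V" "0 \<le> p" "p \<le> 1" "(1 - p) ^ l \<le> 1 / 2"
    and cut: "\<And>U. U \<noteq> {} \<Longrightarrow> U \<subset> V \<Longrightarrow> l \<le> card (E \<inter> U \<times> (- U))"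
  shows "expect p E (\<lambda>S. excess V (A \<union> S)) \<le> 3 / 4 * excess V A"
proof -
  let ?c = "card (comps V A)"
  let ?good = "\<lambda>S. {C \<in> comps V A. S \<inter> C \<times> (- C) \<noteq> {}}"
  have finE: "finite E" using assms(1,2) by (auto intro: finite_subset)
  have finC: "finite (comps V A)" using assms(1) by (simp add: comps_def)
  have le: "real (card (comps V (A \<union> S))) \<le> real ?c - real (card (?good S)) / 2" if "S \<subseteq> E" for S
    using comps_merge[of V A S] assms(1-3) that by (auto simp: field_simps)
  show ?thesis
  proof (cases "?c \<ge> 2")
    case False
    have "excess V (A \<union> S) = 0" if "S \<subseteq> E" for S
      using le[OF that] False by (auto simp: excess_def)
    then have "expect p E (\<lambda>S. excess V (A \<union> S)) = expect p E (\<lambda>S. 0)"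
      by (intro expect_cong) auto
    then show ?thesis using finE False by (simp add: excess_def)
  next
    case True
    have "expect p E (\<lambda>S. excess V (A \<union> S)) \<le>
        expect p E (\<lambda>S. real ?c - 1/2 * (\<Sum>C\<in>comps V A. 1 - of_bool (S \<inter> (E \<inter> C \<times> (- C)) = {})))"
    proof (intro expect_mono)
      fix S assume S: "S \<subseteq> E"
      \<comment> \<open>Intersecting the cut with \<open>E\<close> makes it a set of coordinates, as
        \<open>expect_avoid\<close> demands.\<close>
      have "(\<Sum>C\<in>comps V A. (1::real) - of_bool (S \<inter> (E \<inter> C \<times> (- C)) = {})) =
          (\<Sum>C\<in>comps V A. of_bool (S \<inter> C \<times> (- C) \<noteq> {}))"
      proof (intro sum.cong refl)
        fix C
        have "S \<inter> (E \<inter> C \<times> (- C)) = S \<inter> C \<times> (- C)" using S by auto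
        then show "1 - of_bool (S \<inter> (E \<inter> C \<times> (- C)) = {}) = (of_bool (S \<inter> C \<times> (- C) \<noteq> {}) :: real)"
          by simp
      qed
      also have "\<dots> = real (card (?good S))"
        using finC by (simp add: of_bool_def sum.If_cases Int_def)
      finally show "excess V (A \<union> S) \<le>
          real ?c - 1/2 * (\<Sum>C\<in>comps V A. 1 - of_bool (S \<inter> (E \<inter> C \<times> (- C)) = {}))"
        using le[OF S] unfolding excess_def by (auto split: if_splits)
    qed (use assms(4,5) in auto)
    also have "\<dots> = real ?c - 1/2 * (\<Sum>C\<in>comps V A. 1 - (1 - p) ^ card (E \<inter> C \<times> (- C)))"
      unfolding expect_diff expect_cmult expect_sum using finE by (simp add: expect_avoid)
    also have "\<dots> \<le> real ?c - 1/2 * (\<Sum>C\<in>comps V A. 1/2)"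
    proof -
      have "1/2 \<le> 1 - (1 - p) ^ card (E \<inter> C \<times> (- C))" if C: "C \<in> comps V A" for C
      proof -
        have "C \<noteq> {}" "C \<subset> V"
          using comps_subset[OF assms(3) C] comps_proper[OF C True] by auto
        then have "l \<le> card (E \<inter> C \<times> (- C))" by (rule cut)
        then have "(1 - p) ^ card (E \<inter> C \<times> (- C)) \<le> (1 - p) ^ l"
          using assms(4,5) by (intro power_decreasing) auto
        then show ?thesis using assms(6) by simp
      qed
      then have "(\<Sum>C\<in>comps V A. 1/2) \<le> (\<Sum>C\<in>comps V A. 1 - (1 - p) ^ card (E \<inter> C \<times> (- C)))"
        by (rule sum_mono)
      then show ?thesis by simp
    qed
    also have "\<dots> = 3/4 * excess V A" using True by (simp add: excess_def)
    finally show ?thesis .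
  qed
qed

text \<open>The coins of each new level are fresh, so the contraction applies to whatever the
  earlier levels have kept.\<close>

lemma expect_excess_levels:
  assumes "finite V" "E \<subseteq> V \<times> V" "0 \<le> p" "p \<le> 1" "(1 - p) ^ l \<le> 1 / 2"
    and cut: "\<And>U. U \<noteq> {} \<Longrightarrow> U \<subset> V \<Longrightarrow> l \<le> card (E \<inter> U \<times> (- U))"
  shows "expect p (E \<times> {1..R}) (\<lambda>S. excess V (fst ` S)) \<le> (3 / 4) ^ R * real (card V)"
proof (induction R)
  case 0
  have "card (comps V {}) \<le> card V" unfolding comps_def using assms(1) by (rule card_image_le)
  then show ?case by (simp add: excess_def)
next
  case (Suc R)
  have finE: "finite E" using assms(1,2) by (auto intro: finite_subset)
  have inj: "inj_on (\<lambda>e. (e, Suc R)) E" by (auto simp: inj_on_def)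
  have *: "E \<times> {1..Suc R} = E \<times> {1..R} \<union> (\<lambda>e. (e, Suc R)) ` E"
    by (auto simp: le_Suc_eq)
  have "expect p (E \<times> {1..Suc R}) (\<lambda>S. excess V (fst ` S)) =
      expect p (E \<times> {1..R}) (\<lambda>S. expect p ((\<lambda>e. (e, Suc R)) ` E) (\<lambda>T. excess V (fst ` (S \<union> T))))"
    unfolding * using finE by (intro expect_Un) auto
  also have "\<dots> = expect p (E \<times> {1..R}) (\<lambda>S. expect p E (\<lambda>T. excess V (fst ` S \<union> T)))"
    by (simp add: expect_image[OF inj] image_Un image_image)
  also have "\<dots> \<le> expect p (E \<times> {1..R}) (\<lambda>S. 3/4 * excess V (fst ` S))"
  proof (rule expect_mono[OF assms(3,4)])
    fix S assume "S \<subseteq> E \<times> {1..R}"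
    then have "fst ` S \<subseteq> V \<times> V" using assms(2) by force
    then show "expect p E (\<lambda>T. excess V (fst ` S \<union> T)) \<le> 3/4 * excess V (fst ` S)"
      using cut by (rule expect_excess_step[OF assms(1,2) _ assms(3-5)])
  qed
  also have "\<dots> \<le> 3/4 * ((3/4) ^ R * real (card V))"
    unfolding expect_cmult using Suc by (intro mult_left_mono) auto
  finally show ?case by simp
qed

section \<open>Diameter of a connected graph with a sampled tree\<close>

text \<open>Adding \<open>Id\<close> lets walks idle, so that \<open>t\<close> is an upper bound on
  the length and walk bounds are monotone in \<open>t\<close>.\<close>

definition steps :: "'a rel \<Rightarrow> nat \<Rightarrow> 'a rel" where
  "steps Q t = (Q \<union> Id) ^^ t"

lemma steps_0 [simp]: "steps Q 0 = Id"
  by (simp add: steps_def)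

lemma steps_1 [simp]: "steps Q (Suc 0) = Q \<union> Id"
  by (simp add: steps_def)

lemma steps_Suc: "steps Q (Suc t) = steps Q t O (Q \<union> Id)"
  by (simp add: steps_def)

lemma steps_add: "steps Q (s + t) = steps Q s O steps Q t"
  by (simp add: steps_def relpow_add)

lemma steps_trans:
  assumes "(x, y) \<in> steps Q s" "(y, z) \<in> steps Q t" "s + t \<le> u"
  shows "(x, z) \<in> steps Q u"
proof -
  have refl: "(z, z) \<in> steps Q k" for k
    by (induction k) (auto simp: steps_Suc)
  have "(x, z) \<in> steps Q (s + t)" using assms by (auto simp: steps_add)
  then have "(x, z) \<in> steps Q (s + t + (u - (s + t)))"
    unfolding steps_add[of _ "s + t"] using refl by blast
  then show ?thesis using assms by simp
qed

lemma steps_refl [simp]: "(x, x) \<in> steps Q t"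
  using steps_trans[of x x Q 0 x 0 t] by simp

lemma steps_mono: "Q \<subseteq> Q' \<Longrightarrow> s \<le> t \<Longrightarrow> steps Q s \<subseteq> steps Q' t"
proof -
  assume Q: "Q \<subseteq> Q'" and st: "s \<le> t"
  have "steps Q s \<subseteq> steps Q' s"
    by (induction s) (use Q in \<open>auto simp: steps_Suc\<close>)
  then show ?thesis using st steps_trans[of _ _ Q' s _ 0 t] by auto
qed

lemma sym_steps:
  assumes "sym Q"
  shows "sym (steps Q t)"
proof (induction t)
  case (Suc t)
  have "(Q \<union> Id)\<inverse> = Q \<union> Id" using assms by (simp add: sym_conv_converse_eq converse_Un)
  then have "(steps Q (Suc t))\<inverse> = (Q \<union> Id) O steps Q t"
    using Suc unfolding steps_Suc converse_relcomp sym_conv_converse_eq by metis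
  also have "\<dots> = steps Q (Suc t)"
    using steps_add[of Q 1 t] by (simp add: steps_1)
  finally show ?case by (simp add: sym_conv_converse_eq)
qed (auto intro: symI)

lemma steps_subset_rtrancl: "steps Q t \<subseteq> Q\<^sup>*"
  by (induction t) (auto simp: steps_Suc intro: rtrancl_into_rtrancl)

lemma steps_scale:
  assumes "Q' \<subseteq> steps Q c"
  shows "steps Q' t \<subseteq> steps Q (c * t)"
proof (induction t)
  case (Suc t)
  have "(x, z) \<in> steps Q (c * Suc t)" if "(x, y) \<in> steps Q' t" "(y, z) \<in> Q' \<union> Id" for x y z
    by (rule steps_trans[of x y Q "c * t" z c]) (use that Suc assms in auto)
  then show ?case by (auto simp: steps_Suc)
qed simp

lemma steps_image_subset:
  assumes "H \<subseteq> W \<times> W" "v \<in> W"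
  shows "steps H t `` {v} \<subseteq> W"
proof -
  have "w \<in> W" if "(v, w) \<in> H\<^sup>*" for w
    using that by (induction rule: rtrancl_induct) (use assms in auto)
  then show ?thesis using steps_subset_rtrancl[of H t] by auto
qed

text \<open>A ball that fails to grow is closed under \<open>H\<close> and thus contains everything
  reachable, including \<open>r\<close>. While \<open>r\<close> is missing, each step therefore adds
  a vertex.\<close>

lemma card_steps_ball:
  assumes "finite W" "H \<subseteq> W \<times> W" "v \<in> W" "(v, r) \<in> H\<^sup>*" "r \<notin> steps H t `` {v}"
  shows "t < card (steps H t `` {v})"
  using assms(5)
proof (induction t)
  case 0
  have "steps H 0 `` {v} = {v}" by auto
  then show ?case by simp
next
  case (Suc t)
  let ?B = "\<lambda>t. steps H t `` {v}"
  have sub: "?B t \<subseteq> ?B (Suc t)" using steps_mono[of H H t "Suc t"] by auto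
  have "?B t \<noteq> ?B (Suc t)"
  proof
    assume eq: "?B t = ?B (Suc t)"
    have "w \<in> ?B t" if "(v, w) \<in> H\<^sup>*" for w
      using that
    proof (induction rule: rtrancl_induct)
      case (step y z)
      then have "z \<in> ?B (Suc t)" by (auto simp: steps_Suc)
      then show ?case using eq by simp
    qed simp
    then show False using assms(4) Suc.prems eq by blast
  qed
  then have "?B t \<subset> ?B (Suc t)" using sub by blast
  moreover have "finite (?B (Suc t))"
    using steps_image_subset[OF assms(2,3)] assms(1) by (rule finite_subset)
  ultimately have "card (?B t) < card (?B (Suc t))" by (rule psubset_card_mono[rotated])
  moreover have "t < card (?B t)" using Suc.prems sub by (intro Suc.IH) auto
  ultimately show ?case by simp
qed

section \<open>Contracting the deepest layer of a tree\<close>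

definition up_arcs :: "('a \<Rightarrow> 'a) \<Rightarrow> 'a set \<Rightarrow> 'a rel" where
  "up_arcs \<pi> Z = (\<lambda>v. (v, \<pi> v)) ` Z \<union> (\<lambda>v. (\<pi> v, v)) ` Z"

lemma up_arcs_Un: "up_arcs \<pi> (Y \<union> Z) = up_arcs \<pi> Y \<union> up_arcs \<pi> Z"
  by (auto simp: up_arcs_def)

lemma sym_up_arcs: "sym (up_arcs \<pi> Z)"
  by (auto simp: up_arcs_def intro!: symI)

text \<open>Move every \<open>z\<close> to some \<open>c z\<close> in \<open>W\<close> at most
  \<open>L + 1\<close> steps away. An arc \<open>(y, z)\<close> of \<open>H\<close> turns into the
  detour from \<open>c y\<close> over \<open>y\<close> and \<open>z\<close> to \<open>c z\<close>,
  of length \<open>2 * (L + 1) + 1\<close>; hence the \<open>2 * L + 3\<close> in \<open>H'\<close>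
  and its connectedness. Conversely, \<open>m\<close> steps in the contracted graph expand to
  \<open>(2 * L + 3) * m\<close>, and reaching \<open>W\<close> from both ends costs
  \<open>2 * (L + 1)\<close> more, which is one less than another factor
  \<open>2 * L + 3\<close>.\<close>

lemma tree_collapse:
  assumes "sym H" "W \<subseteq> W'" "\<And>x y. x \<in> W' \<Longrightarrow> y \<in> W' \<Longrightarrow> (x, y) \<in> H\<^sup>*"
    and "H \<subseteq> W' \<times> W'" "H \<subseteq> Q" "sym Q"
    and c: "\<And>z. z \<in> W' \<Longrightarrow> \<exists>c\<in>W. (z, c) \<in> steps Q (L + 1)"
    and H': "H' = {(x, y) \<in> W \<times> W. (x, y) \<in> steps Q (2 * L + 3)}"
  shows "\<And>x y. x \<in> W \<Longrightarrow> y \<in> W \<Longrightarrow> (x, y) \<in> H'\<^sup>*"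
    and "(\<And>x y. x \<in> W \<Longrightarrow> y \<in> W \<Longrightarrow> (x, y) \<in> steps (H' \<union> Q') m) \<Longrightarrow> x \<in> W' \<Longrightarrow> y \<in> W' \<Longrightarrow>
      (x, y) \<in> steps (Q \<union> Q') ((2 * L + 3) * Suc m - 1)"
proof -
  \<comment> \<open>\<open>c\<close> is chosen as the identity on \<open>W\<close>, so that
    connecting the images of two vertices of \<open>W\<close> connects the vertices
    themselves.\<close>
  have "\<exists>c. (z \<in> W' \<longrightarrow> c \<in> W \<and> (z, c) \<in> steps Q (L + 1)) \<and> (z \<in> W \<longrightarrow> c = z)" for z
  proof (cases "z \<in> W")
    case True
    then show ?thesis by (intro exI[of _ z]) auto
  next
    case False
    then show ?thesis using c[of z] by (cases "z \<in> W'") auto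
  qed
  then obtain c where c: "\<And>z. z \<in> W' \<Longrightarrow> c z \<in> W" "\<And>z. z \<in> W' \<Longrightarrow> (z, c z) \<in> steps Q (L + 1)"
    "\<And>z. z \<in> W \<Longrightarrow> c z = z" by metis
  have cs: "(c z, z) \<in> steps Q (L + 1)" if "z \<in> W'" for z
    using sym_steps[OF assms(6)] c(2)[OF that] by (rule symD)
  have conn: "(c x, c z) \<in> H'\<^sup>*" if "(x, z) \<in> H\<^sup>*" for x z
    using that
  proof (induction rule: rtrancl_induct)
    case (step y z)
    then have yz: "y \<in> W'" "z \<in> W'" "(y, z) \<in> steps Q 1" using assms(4,5) by auto
    have "(c y, z) \<in> steps Q (L + 2)"
      by (rule steps_trans[OF cs yz(3)]) (use yz in auto)
    then have "(c y, c z) \<in> steps Q (2 * L + 3)"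
      by (rule steps_trans[OF _ c(2)]) (use yz in auto)
    then have "(c y, c z) \<in> H'" using H' c(1) yz by auto
    then show ?case using step.IH by (rule rtrancl_into_rtrancl[rotated])
  qed simp
  show "(x, y) \<in> H'\<^sup>*" if "x \<in> W" "y \<in> W" for x y
  proof -
    have "(c x, c y) \<in> H'\<^sup>*" using assms(2) that by (intro conn assms(3)) auto
    then show ?thesis by (simp only: c(3)[OF that(1)] c(3)[OF that(2)])
  qed
  assume *: "\<And>x y. x \<in> W \<Longrightarrow> y \<in> W \<Longrightarrow> (x, y) \<in> steps (H' \<union> Q') m" and xy: "x \<in> W'" "y \<in> W'"
  have "H' \<union> Q' \<subseteq> steps (Q \<union> Q') (2 * L + 3)"
  proof -
    have "steps Q (2 * L + 3) \<subseteq> steps (Q \<union> Q') (2 * L + 3)" by (intro steps_mono) auto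
    moreover have "steps (Q \<union> Q') (Suc 0) \<subseteq> steps (Q \<union> Q') (2 * L + 3)" by (intro steps_mono) auto
    ultimately show ?thesis using H' by auto
  qed
  from steps_scale[OF this, of m]
  have mid: "(c x, c y) \<in> steps (Q \<union> Q') ((2 * L + 3) * m)" using * c(1) xy by blast
  have le: "steps Q (L + 1) \<subseteq> steps (Q \<union> Q') (L + 1)" by (intro steps_mono) auto
  have "(x, c y) \<in> steps (Q \<union> Q') (L + 1 + (2 * L + 3) * m)"
    by (rule steps_trans[OF _ mid]) (use c(2)[OF xy(1)] le in auto)
  then show "(x, y) \<in> steps (Q \<union> Q') ((2 * L + 3) * Suc m - 1)"
    by (rule steps_trans[of _ _ _ _ _ "L + 1"]) (use cs[OF xy(2)] le in auto)
qed

text \<open>In the inductive step the coins \<open>Z1\<close> of depth \<open>Suc k\<close> are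
  exposed first; they determine the contracted graph, to which the induction hypothesis applies with
  the independent coins \<open>Z2\<close>. The step fails only if some ball of radius
  \<open>L\<close> stays in the deepest layer and none of its vertices keeps its parent edge. Such a
  ball misses the root, so it has more than \<open>L\<close> vertices. The distance bound solves
  \<open>m (Suc k) = (2 * L + 3) * Suc (m k) - 1\<close> with \<open>m 0 = 0\<close>.\<close>

lemma expect_tree_diameter:
  fixes d :: "'a \<Rightarrow> nat"
  assumes "finite V" "r \<in> V" "d r = 0" "0 \<le> p" "p \<le> 1"
    and root: "\<And>v. v \<in> V \<Longrightarrow> d v = 0 \<Longrightarrow> v = r"
    and parent: "\<And>v k. v \<in> V \<Longrightarrow> d v = Suc k \<Longrightarrow> \<pi> v \<in> V \<and> d (\<pi> v) = k"
    and "H \<subseteq> {v\<in>V. d v \<le> k} \<times> {v\<in>V. d v \<le> k}" "sym H"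
    and "\<And>x y. x \<in> {v\<in>V. d v \<le> k} \<Longrightarrow> y \<in> {v\<in>V. d v \<le> k} \<Longrightarrow> (x, y) \<in> H\<^sup>*"
  shows "expect p {v\<in>V. 1 \<le> d v \<and> d v \<le> k} (\<lambda>Z. of_bool (\<not> (\<forall>x\<in>{v\<in>V. d v \<le> k}.
      \<forall>y\<in>{v\<in>V. d v \<le> k}. (x, y) \<in> steps (H \<union> up_arcs \<pi> Z) ((2 * L + 3) ^ k - 1))))
    \<le> real k * (real (card V) * (1 - p) ^ L)"
  using assms(8-10)
proof (induction k arbitrary: H)
  case 0
  have empty: "{v\<in>V. 1 \<le> d v \<and> d v \<le> 0} = {}" by auto
  have "x = r" if "x \<in> {v\<in>V. d v \<le> 0}" for x using root[of x] that by simp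
  then have near: "\<forall>x\<in>{v\<in>V. d v \<le> 0}. \<forall>y\<in>{v\<in>V. d v \<le> 0}. (x, y) \<in> steps Q t" for Q t
    by (metis steps_refl)
  have "of_bool (\<not> X) \<le> real 0 * z" if X for X and z :: real using that by simp
  then show ?case unfolding empty expect_empty using near by blast
next
  case (Suc k)
  let ?W = "{v\<in>V. d v \<le> k}" and ?W' = "{v\<in>V. d v \<le> Suc k}"
  let ?I1 = "{v\<in>V. d v = Suc k}" and ?I2 = "{v\<in>V. 1 \<le> d v \<and> d v \<le> k}"
  let ?B = "\<lambda>v. steps H L `` {v}"
  let ?bad = "\<lambda>Z. \<exists>v\<in>?I1. ?B v \<subseteq> ?I1 \<and> Z \<inter> ?B v = {}"
  let ?far = "\<lambda>Z. \<not> (\<forall>x\<in>?W'. \<forall>y\<in>?W'. (x, y) \<in> steps (H \<union> up_arcs \<pi> Z) ((2 * L + 3) ^ Suc k - 1))"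
  let ?\<epsilon> = "real k * (real (card V) * (1 - p) ^ L)"
  have "{v\<in>V. 1 \<le> d v \<and> d v \<le> Suc k} = ?I1 \<union> ?I2" by auto
  then have "expect p {v\<in>V. 1 \<le> d v \<and> d v \<le> Suc k} (\<lambda>Z. of_bool (?far Z)) =
      expect p ?I1 (\<lambda>Z1. expect p ?I2 (\<lambda>Z2. of_bool (?far (Z1 \<union> Z2))))"
    using assms(1) by (simp only: expect_Un[of ?I1 ?I2]) (subst expect_Un; auto)
  also have "\<dots> \<le> expect p ?I1 (\<lambda>Z1. of_bool (?bad Z1) + ?\<epsilon>)"
  proof (rule expect_mono[OF assms(4,5)])
    fix Z1 assume Z1: "Z1 \<subseteq> ?I1"
    show "expect p ?I2 (\<lambda>Z2. of_bool (?far (Z1 \<union> Z2))) \<le> of_bool (?bad Z1) + ?\<epsilon>"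
    proof (cases "?bad Z1")
      case True
      have "expect p ?I2 (\<lambda>Z2. of_bool (?far (Z1 \<union> Z2))) \<le> 1"
        using assms by (intro expect_le) auto
      also have "\<dots> \<le> of_bool (?bad Z1) + ?\<epsilon>" using True assms(4,5) by simp
      finally show ?thesis .
    next
      case False
      let ?Q = "H \<union> up_arcs \<pi> Z1"
      define H' where "H' = {(x, y) \<in> ?W \<times> ?W. (x, y) \<in> steps ?Q (2 * L + 3)}"
      have symQ: "sym ?Q" using Suc.prems(2) sym_up_arcs by (rule sym_Un)
      have c: "\<exists>c\<in>?W. (z, c) \<in> steps ?Q (L + 1)" if z: "z \<in> ?W'" for z
      proof (cases "z \<in> ?W")
        case True
        then show ?thesis by (intro bexI[of _ z]) auto
      next
        case zI: False
        then have "z \<in> ?I1" using z by auto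
        \<comment> \<open>Either the ball itself leaves the deepest layer, or one of its vertices
          has a sampled parent edge.\<close>
        then consider "\<not> ?B z \<subseteq> ?I1" | "Z1 \<inter> ?B z \<noteq> {}" using False by blast
        then show ?thesis
        proof cases
          case 1
          then obtain u where u: "(z, u) \<in> steps H L" "u \<notin> ?I1" by auto
          then have "u \<in> ?W" using steps_image_subset[OF Suc.prems(1) z, of L] by force
          moreover have "(z, u) \<in> steps ?Q (L + 1)" using u(1) steps_mono[of H ?Q L "L + 1"] by auto
          ultimately show ?thesis by blast
        next
          case 2
          then obtain u where u: "(z, u) \<in> steps H L" "u \<in> Z1" by auto
          then have "\<pi> u \<in> ?W" using parent[of u k] Z1 by auto
          moreover have "(u, \<pi> u) \<in> steps ?Q 1" using u by (auto simp: up_arcs_def)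
          then have "(z, \<pi> u) \<in> steps ?Q (L + 1)"
            using steps_trans[of z u ?Q L "\<pi> u" 1 "L + 1"] u(1) steps_mono[of H ?Q L L] by auto
          ultimately show ?thesis by blast
        qed
      qed
      have sub: "?W \<subseteq> ?W'" by auto
      note collapse = tree_collapse[OF Suc.prems(2) sub Suc.prems(3) Suc.prems(1) Un_upper1 symQ c H'_def]
      have "sym H'"
        using symD[OF sym_steps[OF symQ]] by (auto simp: H'_def intro!: symI)
      then have IH: "expect p ?I2 (\<lambda>Z. of_bool (\<not> (\<forall>x\<in>?W. \<forall>y\<in>?W.
          (x, y) \<in> steps (H' \<union> up_arcs \<pi> Z) ((2 * L + 3) ^ k - 1)))) \<le> ?\<epsilon>"
        using collapse(1) by (intro Suc.IH) (auto simp: H'_def)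
      have "expect p ?I2 (\<lambda>Z2. of_bool (?far (Z1 \<union> Z2))) \<le> expect p ?I2 (\<lambda>Z. of_bool (\<not> (\<forall>x\<in>?W. \<forall>y\<in>?W.
          (x, y) \<in> steps (H' \<union> up_arcs \<pi> Z) ((2 * L + 3) ^ k - 1))))"
      proof (rule expect_mono[OF assms(4,5)])
        fix Z2
        have "\<not> ?far (Z1 \<union> Z2)" if *: "\<forall>x\<in>?W. \<forall>y\<in>?W.
          (x, y) \<in> steps (H' \<union> up_arcs \<pi> Z2) ((2 * L + 3) ^ k - 1)"
        proof -
          have "(x, y) \<in> steps (?Q \<union> up_arcs \<pi> Z2) ((2 * L + 3) * Suc ((2 * L + 3) ^ k - 1) - 1)"
            if "x \<in> ?W'" "y \<in> ?W'" for x y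
            by (rule collapse(2)) (use * that in blast)+
          \<comment> \<open>The power is positive, so \<open>Suc\<close> undoes the truncated
            subtraction.\<close>
          then show ?thesis by (simp add: up_arcs_Un Un_assoc)
        qed
        then show "of_bool (?far (Z1 \<union> Z2)) \<le> (of_bool (\<not> (\<forall>x\<in>?W. \<forall>y\<in>?W.
          (x, y) \<in> steps (H' \<union> up_arcs \<pi> Z2) ((2 * L + 3) ^ k - 1))) :: real)"
          by (auto simp: of_bool_def)
      qed
      then show ?thesis using IH False by simp
    qed
  qed
  also have "\<dots> = expect p ?I1 (\<lambda>Z1. of_bool (?bad Z1)) + ?\<epsilon>"
    using assms(1) by (simp add: expect_add)
  \<comment> \<open>Union bound over the centres of balls that lie in the deepest layer.\<close>
  also have "expect p ?I1 (\<lambda>Z1. of_bool (?bad Z1)) \<le>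
      expect p ?I1 (\<lambda>Z1. \<Sum>v\<in>{v\<in>?I1. ?B v \<subseteq> ?I1}. of_bool (Z1 \<inter> ?B v = {}))"
  proof (rule expect_mono[OF assms(4,5)])
    fix Z1
    show "of_bool (?bad Z1) \<le> (\<Sum>v\<in>{v\<in>?I1. ?B v \<subseteq> ?I1}. of_bool (Z1 \<inter> ?B v = {}) :: real)"
    proof (cases "?bad Z1")
      case True
      then obtain v where v: "v \<in> ?I1" "?B v \<subseteq> ?I1" "Z1 \<inter> ?B v = {}" by blast
      have "of_bool (Z1 \<inter> ?B v = {}) \<le> (\<Sum>v\<in>{v\<in>?I1. ?B v \<subseteq> ?I1}. of_bool (Z1 \<inter> ?B v = {}) :: real)"
        using v assms(1) by (intro member_le_sum) auto
      then show ?thesis using v True by simp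
    next
      case False
      then have "of_bool (?bad Z1) = (0::real)" by simp
      moreover have "0 \<le> (\<Sum>v\<in>{v\<in>?I1. ?B v \<subseteq> ?I1}. of_bool (Z1 \<inter> ?B v = {}) :: real)"
        by (rule sum_nonneg) simp
      ultimately show ?thesis by linarith
    qed
  qed
  also have "\<dots> = (\<Sum>v\<in>{v\<in>?I1. ?B v \<subseteq> ?I1}. (1 - p) ^ card (?B v))"
    unfolding expect_sum using assms(1) by (intro sum.cong refl expect_avoid) auto
  also have "\<dots> \<le> (\<Sum>v\<in>{v\<in>?I1. ?B v \<subseteq> ?I1}. (1 - p) ^ L)"
  proof (rule sum_mono)
    fix v assume v: "v \<in> {v\<in>?I1. ?B v \<subseteq> ?I1}"
    then have "r \<notin> ?B v" using assms(3) by auto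
    moreover have "finite ?W'" "v \<in> ?W'" "(v, r) \<in> H\<^sup>*" using assms(1-3) v by (auto intro: Suc.prems(3))
    ultimately have "L < card (?B v)" using card_steps_ball[of ?W' H v r L] Suc.prems(1) by blast
    then show "(1 - p) ^ card (?B v) \<le> (1 - p) ^ L" using assms(4,5) by (intro power_decreasing) auto
  qed
  also have "\<dots> \<le> real (card V) * (1 - p) ^ L"
  proof -
    have "card {v\<in>?I1. ?B v \<subseteq> ?I1} \<le> card V" using assms(1) by (intro card_mono) auto
    then show ?thesis using assms(5) by (simp add: mult_right_mono)
  qed
  finally show ?case by (simp add: algebra_simps)
qed

text \<open>\<open>d\<close> is the distance from \<open>r\<close>, and the parent is the last
  vertex before \<open>v\<close> on a shortest walk.\<close>

lemma bfs_tree: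
  assumes "E \<subseteq> V \<times> V" "sym E" "r \<in> V" "\<And>v. v \<in> V \<Longrightarrow> (r, v) \<in> steps E D"
  obtains d \<pi> where "d r = (0::nat)" "\<And>v. v \<in> V \<Longrightarrow> d v \<le> D" "\<And>v. v \<in> V \<Longrightarrow> d v = 0 \<Longrightarrow> v = r"
    "\<And>v k. v \<in> V \<Longrightarrow> d v = Suc k \<Longrightarrow> \<pi> v \<in> V \<and> d (\<pi> v) = k"
    "\<And>v k. v \<in> V \<Longrightarrow> d v = Suc k \<Longrightarrow> (v, \<pi> v) \<in> E"
proof -
  define d where "d v = (LEAST t. (r, v) \<in> steps E t)" for v
  have le: "d v \<le> t" if "(r, v) \<in> steps E t" for v t
    unfolding d_def using that by (rule Least_le)
  have reach: "(r, v) \<in> steps E (d v)" if "v \<in> V" for v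
    unfolding d_def using assms(4)[OF that] by (rule LeastI)
  have "\<exists>u. \<forall>k. v \<in> V \<longrightarrow> d v = Suc k \<longrightarrow> u \<in> V \<and> d u = k \<and> (v, u) \<in> E" for v
  proof (cases "v \<in> V \<and> d v \<noteq> 0")
    case True
    then obtain k where k: "d v = Suc k" using not0_implies_Suc by blast
    then obtain u where u: "(r, u) \<in> steps E k" "(u, v) \<in> E \<union> Id"
      using reach[of v] True by (auto simp: steps_Suc)
    have "u \<noteq> v" using le[OF u(1)] k by auto
    then have uv: "(u, v) \<in> E" using u(2) by auto
    have "(r, v) \<in> steps E (Suc (d u))"
      using reach[of u] uv assms(1) by (auto simp: steps_Suc)
    then have "d u = k" using le[OF u(1)] le[of v "Suc (d u)"] k by simp
    then show ?thesis using uv k assms(1) symD[OF assms(2) uv] by auto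
  qed auto
  then obtain \<pi> where \<pi>: "\<And>v k. v \<in> V \<Longrightarrow> d v = Suc k \<Longrightarrow> \<pi> v \<in> V \<and> d (\<pi> v) = k \<and> (v, \<pi> v) \<in> E"
    by metis
  show ?thesis
  proof (rule that[of d \<pi>])
    show "d r = 0" using le[of r 0] by simp
    show "v = r" if "v \<in> V" "d v = 0" for v using reach[OF that(1)] that(2) by simp
  qed (use le assms(4) \<pi> in auto)
qed

text \<open>Levels \<open>1..R\<close> provide the connected graph and level 0 the tree,
  independently. If the former is disconnected, the trivial bound 1 is charged to
  \<open>excess\<close>; otherwise the tree bound applies with all of \<open>V\<close> as the layers
  up to \<open>D\<close>.\<close>

lemma expect_sampled_diameter:
  assumes "finite V" "E \<subseteq> V \<times> V" "sym E" "V \<noteq> {}" "0 \<le> p" "p \<le> 1" "(1 - p) ^ l \<le> 1 / 2"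
    and walks: "\<And>u v. u \<in> V \<Longrightarrow> v \<in> V \<Longrightarrow> (u, v) \<in> steps E D"
    and cut: "\<And>U. U \<noteq> {} \<Longrightarrow> U \<subset> V \<Longrightarrow> l \<le> card (E \<inter> U \<times> (- U))"
  shows "expect p (E \<times> {..R}) (\<lambda>S. of_bool (\<not> (\<forall>x\<in>V. \<forall>y\<in>V.
      (x, y) \<in> steps (fst ` S \<union> (fst ` S)\<inverse>) ((2 * L + 3) ^ D - 1))))
    \<le> (3 / 4) ^ R * real (card V) + real D * (real (card V) * (1 - p) ^ L)"
proof -
  obtain r where r: "r \<in> V" using assms(4) by auto
  obtain d \<pi> where d: "d r = (0::nat)" "\<And>v. v \<in> V \<Longrightarrow> d v \<le> D" "\<And>v. v \<in> V \<Longrightarrow> d v = 0 \<Longrightarrow> v = r"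
    and \<pi>: "\<And>v k. v \<in> V \<Longrightarrow> d v = Suc k \<Longrightarrow> \<pi> v \<in> V \<and> d (\<pi> v) = k"
    and \<pi>E: "\<And>v k. v \<in> V \<Longrightarrow> d v = Suc k \<Longrightarrow> (v, \<pi> v) \<in> E"
    using bfs_tree[OF assms(2,3) r walks[OF r]] by blast
  have finE: "finite E" using assms(1,2) by (auto intro: finite_subset)
  let ?t = "(2 * L + 3) ^ D - 1"
  let ?far = "\<lambda>Q. \<not> (\<forall>x\<in>V. \<forall>y\<in>V. (x, y) \<in> steps Q ?t)"
  let ?K = "\<lambda>S. fst ` S \<union> (fst ` S)\<inverse>"
  let ?J = "{v\<in>V. 1 \<le> d v \<and> d v \<le> D}"
  let ?\<epsilon> = "real D * (real (card V) * (1 - p) ^ L)"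
  have V: "{v\<in>V. d v \<le> D} = V" using d(2) by auto
  have "E \<times> {..R} = E \<times> {1..R} \<union> E \<times> {0}" by auto
  then have "expect p (E \<times> {..R}) (\<lambda>S. of_bool (?far (?K S))) =
      expect p (E \<times> {1..R}) (\<lambda>S. expect p (E \<times> {0}) (\<lambda>T. of_bool (?far (?K (S \<union> T)))))"
    using finE by (simp only:) (subst expect_Un; auto)
  also have "\<dots> \<le> expect p (E \<times> {1..R}) (\<lambda>S. excess V (fst ` S) + ?\<epsilon>)"
  proof (rule expect_mono[OF assms(5,6)])
    fix S assume S: "S \<subseteq> E \<times> {1..R}"
    show "expect p (E \<times> {0}) (\<lambda>T. of_bool (?far (?K (S \<union> T)))) \<le> excess V (fst ` S) + ?\<epsilon>"
    proof (cases "card (comps V (fst ` S)) \<ge> 2")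
      case True
      have "expect p (E \<times> {0}) (\<lambda>T. of_bool (?far (?K (S \<union> T)))) \<le> 1"
        using assms(5,6) finE by (intro expect_le) auto
      also have "1 \<le> excess V (fst ` S) + ?\<epsilon>"
        using True assms(6) by (simp add: excess_def add_increasing2)
      finally show ?thesis .
    next
      case False
      let ?H = "?K S"
      have H: "?H \<subseteq> {v\<in>V. d v \<le> D} \<times> {v\<in>V. d v \<le> D}" using S assms(2) unfolding V by force
      have conn: "(x, y) \<in> ?H\<^sup>*" if "x \<in> {v\<in>V. d v \<le> D}" "y \<in> {v\<in>V. d v \<le> D}" for x y
        using False assms(1) that by (intro comps_connected[of V]) auto
      \<comment> \<open>Only the arc from \<open>v\<close> to its parent is used as the coin of
        \<open>v\<close>; all other arcs of level 0 can only shorten walks.\<close>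
      have "expect p (E \<times> {0}) (\<lambda>T. of_bool (?far (?K (S \<union> T)))) \<le>
          expect p (E \<times> {0::nat}) (\<lambda>T. of_bool (?far (?H \<union> up_arcs \<pi> {v\<in>?J. ((v, \<pi> v), 0) \<in> T})))"
      proof (rule expect_mono[OF assms(5,6)])
        fix T
        have "?H \<union> up_arcs \<pi> {v\<in>?J. ((v, \<pi> v), 0) \<in> T} \<subseteq> ?K (S \<union> T)"
          by (auto simp: up_arcs_def intro: rev_image_eqI)
        then have "steps (?H \<union> up_arcs \<pi> {v\<in>?J. ((v, \<pi> v), 0) \<in> T}) ?t \<subseteq> steps (?K (S \<union> T)) ?t"
          by (rule steps_mono) simp
        then show "of_bool (?far (?K (S \<union> T))) \<le>
            (of_bool (?far (?H \<union> up_arcs \<pi> {v\<in>?J. ((v, \<pi> v), 0) \<in> T})) :: real)"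
          by (simp add: of_bool_def) blast
      qed
      also have "\<dots> = expect p ?J (\<lambda>Z. of_bool (?far (?H \<union> up_arcs \<pi> Z)))"
      proof (rule expect_vimage[where g = "\<lambda>Z. of_bool (?far (?H \<union> up_arcs \<pi> Z))"])
        show "(\<lambda>v. ((v, \<pi> v), 0)) ` ?J \<subseteq> E \<times> {0}"
          using \<pi>E by (auto simp: Suc_le_eq dest!: gr0_implies_Suc)
      qed (use finE in \<open>auto simp: inj_on_def\<close>)
      also have "\<dots> \<le> ?\<epsilon>"
      proof -
        have "expect p ?J (\<lambda>Z. of_bool (\<not> (\<forall>x\<in>{v\<in>V. d v \<le> D}. \<forall>y\<in>{v\<in>V. d v \<le> D}.
            (x, y) \<in> steps (?H \<union> up_arcs \<pi> Z) ?t))) \<le> ?\<epsilon>"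
        proof (rule expect_tree_diameter[OF assms(1) r d(1) assms(5,6) _ _ H sym_Un_conv])
          show "v = r" if "v \<in> V" "d v = 0" for v using that by (rule d(3))
          show "\<pi> v \<in> V \<and> d (\<pi> v) = k" if "v \<in> V" "d v = Suc k" for v k using that by (rule \<pi>)
          show "(x, y) \<in> ?H\<^sup>*" if "x \<in> {v\<in>V. d v \<le> D}" "y \<in> {v\<in>V. d v \<le> D}" for x y
            using that by (rule conn)
        qed
        then show ?thesis unfolding V .
      qed
      finally show ?thesis using False by (simp add: excess_def)
    qed
  qed
  also have "\<dots> = expect p (E \<times> {1..R}) (\<lambda>S. excess V (fst ` S)) + ?\<epsilon>"
    using finE by (simp add: expect_add)
  also have "expect p (E \<times> {1..R}) (\<lambda>S. excess V (fst ` S)) \<le> (3 / 4) ^ R * real (card V)"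
    using cut by (rule expect_excess_levels[OF assms(1,2,5-7)])
  finally show ?thesis by simp
qed

section \<open>Union bound and independence over the trials\<close>

lemma expect_some_trial:
  fixes R :: nat
  assumes "finite E" "0 \<le> p" "p \<le> 1" "\<epsilon> \<ge> expect p (E \<times> {..R}) (\<lambda>S. of_bool (Q S))"
  shows "expect p (E \<times> {..<J} \<times> {..R}) (\<lambda>S. of_bool (\<exists>j<J. Q {(e, r) \<in> E \<times> {..R}. (e, j, r) \<in> S}))
    \<le> real J * \<epsilon>"
proof -
  let ?X = "E \<times> {..<J} \<times> {..R::nat}"
  let ?S = "\<lambda>j S. {x \<in> E \<times> {..R}. (\<lambda>(e, r). (e, j, r)) x \<in> S}"
  have S: "{(e, r) \<in> E \<times> {..R}. (e, j, r) \<in> S} = ?S j S" for j S by auto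
  have "expect p ?X (\<lambda>S. of_bool (\<exists>j<J. Q (?S j S))) \<le> expect p ?X (\<lambda>S. \<Sum>j<J. of_bool (Q (?S j S)))"
  proof (rule expect_mono[OF assms(2,3)])
    fix S
    show "of_bool (\<exists>j<J. Q (?S j S)) \<le> (\<Sum>j<J. of_bool (Q (?S j S)) :: real)"
    proof (cases "\<exists>j<J. Q (?S j S)")
      case True
      then obtain j where j: "j < J" "Q (?S j S)" by blast
      have "of_bool (Q (?S j S)) \<le> (\<Sum>j<J. of_bool (Q (?S j S)) :: real)"
        using j(1) by (intro member_le_sum[of j "{..<J}" "\<lambda>j. of_bool (Q (?S j S)) :: real"]) auto
      then show ?thesis using j(2) True by simp
    next
      case False
      then have "of_bool (\<exists>j<J. Q (?S j S)) = (0::real)" by simp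
      moreover have "0 \<le> (\<Sum>j<J. of_bool (Q (?S j S)) :: real)" by (rule sum_nonneg) simp
      ultimately show ?thesis by linarith
    qed
  qed
  also have "\<dots> = (\<Sum>j<J. expect p (E \<times> {..R}) (\<lambda>S. of_bool (Q S)))"
    unfolding expect_sum
  proof (intro sum.cong refl)
    fix j assume "j \<in> {..<J}"
    then show "expect p ?X (\<lambda>S. of_bool (Q (?S j S))) = expect p (E \<times> {..R}) (\<lambda>S. of_bool (Q S))"
      using assms(1) by (intro expect_vimage[where g = "\<lambda>S. of_bool (Q S)"]) (auto simp: inj_on_def)
  qed
  also have "\<dots> \<le> real J * \<epsilon>" using assms(4) by (simp add: mult_left_mono)
  finally show ?thesis unfolding S .
qed

text \<open>Different trials use disjoint sets of coins, and within a trial each arc of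
  \<open>F\<close> has \<open>Suc R\<close> of them, all of which must fail to avoid
  \<open>F\<close>.\<close>

lemma expect_no_trial_avoids:
  fixes R :: nat
  assumes "finite E" "F \<subseteq> E"
  shows "expect p (E \<times> {..<J} \<times> {..R}) (\<lambda>S. of_bool (\<forall>j<J. S \<inter> F \<times> {j} \<times> {..R} \<noteq> {})) =
    (1 - (1 - p) ^ (card F * Suc R)) ^ J"
proof (induction J)
  case 0
  then show ?case by simp
next
  case (Suc J)
  let ?X = "E \<times> {..<J} \<times> {..R}" and ?Y = "E \<times> {J} \<times> {..R}"
  let ?hit = "\<lambda>j S. S \<inter> F \<times> {j} \<times> {..R} \<noteq> {}"
  have "E \<times> {..<Suc J} \<times> {..R} = ?X \<union> ?Y" by (auto simp: less_Suc_eq)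
  then have "expect p (E \<times> {..<Suc J} \<times> {..R}) (\<lambda>S. of_bool (\<forall>j<Suc J. ?hit j S)) =
      expect p ?X (\<lambda>S. expect p ?Y (\<lambda>T. of_bool (\<forall>j<Suc J. ?hit j (S \<union> T))))"
    using assms(1) by (simp only:) (subst expect_Un; auto)
  also have "\<dots> = expect p ?X (\<lambda>S. expect p ?Y (\<lambda>T. of_bool (\<forall>j<J. ?hit j S) * (1 - of_bool (T \<inter> F \<times> {J} \<times> {..R} = {}))))"
  proof (intro expect_cong)
    fix S T assume "S \<subseteq> ?X" "T \<subseteq> ?Y"
    then have "?hit j (S \<union> T) \<longleftrightarrow> ?hit j S" if "j < J" for j using that by fastforce
    moreover have "?hit J (S \<union> T) \<longleftrightarrow> ?hit J T" using \<open>S \<subseteq> ?X\<close> by fastforce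
    ultimately have "(\<forall>j<Suc J. ?hit j (S \<union> T)) \<longleftrightarrow> (\<forall>j<J. ?hit j S) \<and> ?hit J T"
      by (simp only: less_Suc_eq) blast
    then show "of_bool (\<forall>j<Suc J. ?hit j (S \<union> T)) =
        (of_bool (\<forall>j<J. ?hit j S) * (1 - of_bool (T \<inter> F \<times> {J} \<times> {..R} = {})) :: real)"
      by (simp only: of_bool_conj of_bool_not_iff)
  qed
  also have "\<dots> = expect p ?X (\<lambda>S. of_bool (\<forall>j<J. ?hit j S) * (1 - (1 - p) ^ card (F \<times> {J} \<times> {..R})))"
  proof -
    have "expect p ?Y (\<lambda>T. of_bool (T \<inter> F \<times> {J} \<times> {..R} = {})) = (1 - p) ^ card (F \<times> {J} \<times> {..R})"
      using assms by (intro expect_avoid) auto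
    then show ?thesis unfolding expect_cmult expect_diff using assms(1) by simp
  qed
  also have "\<dots> = (1 - (1 - p) ^ (card F * Suc R)) ^ Suc J"
    unfolding mult.commute[of "of_bool _" "1 - (1 - p) ^ card (F \<times> {J} \<times> {..R})"] expect_cmult Suc
    by (simp add: card_cartesian_product)
  finally show ?case .
qed

section \<open>Coin strings as random sets\<close>

text \<open>A block of \<open>m\<close> fair bits is all \<open>True\<close> with probability
  \<open>1 / 2 ^ m\<close>, so each block acts as one biased coin.\<close>

definition blocks :: "nat \<Rightarrow> nat \<Rightarrow> bool list \<Rightarrow> nat set" where
  "blocks m M bs = {i. i < M \<and> (\<forall>b<m. bs ! (i * m + b))}"

lemma card_bool_lists: "card {bs :: bool list. length bs = N} = 2 ^ N"
  using card_lists_length_eq[of "UNIV :: bool set" N] by simp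

lemma finite_bool_lists [simp]: "finite {bs :: bool list. length bs = N}"
  using finite_lists_length_eq[of "UNIV :: bool set" N] by simp

text \<open>Split off the last block: exactly one of its \<open>2 ^ m\<close> fillings adds
  \<open>M\<close> to the set.\<close>

lemma sum_bool_lists_blocks:
  "(\<Sum>bs | length bs = M * m. g (blocks m M bs)) = 2 ^ (M * m) * expect (1 / 2 ^ m) {..<M} g"
proof (induction M arbitrary: g)
  case 0
  have "{bs :: bool list. length bs = 0} = {[]}" by auto
  then show ?case by (simp add: blocks_def)
next
  case (Suc M)
  let ?L = "\<lambda>N. {bs :: bool list. length bs = N}"
  have bij: "bij_betw (\<lambda>(xs, ys). xs @ ys) (?L (M * m) \<times> ?L m) (?L (Suc M * m))"
    by (rule bij_betwI[of _ _ _ "\<lambda>bs. (take (M * m) bs, drop (M * m) bs)"]) auto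
  have blocks: "blocks m (Suc M) (xs @ ys) =
      (if ys = replicate m True then insert M (blocks m M xs) else blocks m M xs)"
    if "length xs = M * m" "length ys = m" for xs ys
  proof -
    have last: "(\<forall>b<m. (xs @ ys) ! (M * m + b)) \<longleftrightarrow> ys = replicate m True"
      using that by (auto simp: nth_append list_eq_iff_nth_eq)
    have other: "(xs @ ys) ! (i * m + b) = xs ! (i * m + b)" if "i < M" "b < m" for i b
    proof -
      have "i * m + b < Suc i * m" using that by simp
      also have "\<dots> \<le> M * m" using that by (intro mult_le_mono1) simp
      finally show ?thesis using \<open>length xs = M * m\<close> by (simp add: nth_append)
    qed
    show ?thesis using last other by (auto simp: blocks_def less_Suc_eq)
  qed
  have "(\<Sum>bs\<in>?L (Suc M * m). g (blocks m (Suc M) bs)) =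
      (\<Sum>(xs, ys)\<in>?L (M * m) \<times> ?L m. g (blocks m (Suc M) (xs @ ys)))"
    by (subst sum.reindex_bij_betw[OF bij, symmetric]) (simp add: case_prod_beta)
  also have "\<dots> = (\<Sum>xs\<in>?L (M * m). \<Sum>ys\<in>?L m. g (blocks m (Suc M) (xs @ ys)))"
    by (rule sum.cartesian_product[symmetric])
  also have "\<dots> = (\<Sum>xs\<in>?L (M * m). g (insert M (blocks m M xs)) + (2 ^ m - 1) * g (blocks m M xs))"
  proof (intro sum.cong refl)
    fix xs assume "xs \<in> ?L (M * m)"
    then have "(\<Sum>ys\<in>?L m. g (blocks m (Suc M) (xs @ ys))) =
        (\<Sum>ys\<in>?L m. if ys = replicate m True then g (insert M (blocks m M xs)) else g (blocks m M xs))"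
      by (intro sum.cong refl) (simp add: blocks)
    also have "\<dots> = g (insert M (blocks m M xs)) +
        (\<Sum>ys\<in>?L m - {replicate m True}. g (blocks m M xs))"
      by (subst sum.remove[of _ "replicate m True"]) (auto intro!: sum.cong)
    also have "\<dots> = g (insert M (blocks m M xs)) + (2 ^ m - 1) * g (blocks m M xs)"
      by (simp add: card_Diff_singleton_if card_bool_lists of_nat_diff)
    finally show "(\<Sum>ys\<in>?L m. g (blocks m (Suc M) (xs @ ys))) = \<dots>" .
  qed
  also have "\<dots> = 2 ^ (M * m) * (expect (1 / 2 ^ m) {..<M} (\<lambda>S. g (insert M S)) +
      (2 ^ m - 1) * expect (1 / 2 ^ m) {..<M} g)"
    unfolding sum.distrib sum_distrib_left[symmetric] Suc[of g] Suc[of "\<lambda>S. g (insert M S)"]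
    by (simp add: algebra_simps)
  also have "\<dots> = 2 ^ (Suc M * m) * expect (1 / 2 ^ m) {..<Suc M} g"
    by (simp add: lessThan_Suc expect_insert power_add field_simps)
  finally show ?case .
qed

text \<open>Nodes are added one at a time: the string of the new node is averaged by
  \<open>sum_bool_lists_blocks\<close>, and \<open>expect_Un\<close> joins its coins with those of
  the others.\<close>

lemma expectation_Pi_pmf_blocks:
  assumes "finite V"
  shows "measure_pmf.expectation (Pi_pmf V [] (\<lambda>_. pmf_of_set {bs. length bs = M * m}))
      (\<lambda>\<omega>. g (SIGMA v:V. blocks m M (\<omega> v))) = expect (1 / 2 ^ m) (V \<times> {..<M}) g"
  using assms
proof (induction V arbitrary: g rule: finite_induct)
  case empty
  then show ?case by simp
next
  case (insert x V)
  let ?L = "{bs :: bool list. length bs = M * m}" and ?p = "1 / 2 ^ m :: real"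
  let ?P = "\<lambda>V. Pi_pmf V [] (\<lambda>_. pmf_of_set ?L)"
  have ne: "?L \<noteq> {}" by (auto intro: exI[of _ "replicate (M * m) True"])
  have fin: "finite (set_pmf (?P V))"
    using insert.hyps ne by (subst set_Pi_pmf) auto
  have sig: "(SIGMA v:insert x V. blocks m M ((f(x := y)) v)) =
      Pair x ` blocks m M y \<union> (SIGMA v:V. blocks m M (f v))" for f y
    using insert.hyps by (auto split: if_splits)
  have "measure_pmf.expectation (?P (insert x V)) (\<lambda>\<omega>. g (SIGMA v:insert x V. blocks m M (\<omega> v))) =
      (\<Sum>y\<in>?L. measure_pmf.expectation (map_pmf (\<lambda>f. f(x := y)) (?P V))
        (\<lambda>\<omega>. g (SIGMA v:insert x V. blocks m M (\<omega> v))) /\<^sub>R real (card ?L))"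
    unfolding Pi_pmf_insert'[OF insert.hyps] map_pmf_def[symmetric]
    using ne fin by (intro pmf_expectation_bind_pmf_of_set) auto
  also have "\<dots> = (\<Sum>y\<in>?L. expect ?p (V \<times> {..<M}) (\<lambda>T. g (Pair x ` blocks m M y \<union> T))) / real (card ?L)"
    unfolding integral_map_pmf sig insert.IH[where g = "\<lambda>T. g (Pair x ` B \<union> T)" for B]
    by (simp add: sum_distrib_left divide_inverse mult.commute)
  also have "\<dots> = expect ?p {..<M} (\<lambda>S. expect ?p (V \<times> {..<M}) (\<lambda>T. g (Pair x ` S \<union> T)))"
    unfolding sum_bool_lists_blocks[of "\<lambda>S. expect ?p (V \<times> {..<M}) (\<lambda>T. g (Pair x ` S \<union> T))"]
      card_bool_lists by simp
  also have "\<dots> = expect ?p (Pair x ` {..<M}) (\<lambda>S. expect ?p (V \<times> {..<M}) (\<lambda>T. g (S \<union> T)))"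
    by (subst expect_image) (auto simp: inj_on_def)
  also have "\<dots> = expect ?p (Pair x ` {..<M} \<union> V \<times> {..<M}) g"
    using insert.hyps by (subst expect_Un) auto
  also have "Pair x ` {..<M} \<union> V \<times> {..<M} = insert x V \<times> {..<M}" by auto
  finally show ?case .
qed

lemma prob_Pi_pmf_blocks:
  assumes "finite V" "inj_on h J" "h ` J \<subseteq> V \<times> {..<M}"
  shows "measure_pmf.prob (Pi_pmf V [] (\<lambda>_. pmf_of_set {bs. length bs = M * m}))
      {\<omega>. Q {x \<in> J. h x \<in> (SIGMA v:V. blocks m M (\<omega> v))}} = expect (1 / 2 ^ m) J (\<lambda>S. of_bool (Q S))"
    (is "measure_pmf.prob ?P ?A = _")
proof -
  have "measure_pmf.prob ?P ?A = measure_pmf.expectation ?P (indicator ?A)" by simp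
  also have "indicator ?A = (\<lambda>\<omega>. of_bool (Q {x \<in> J. h x \<in> (SIGMA v:V. blocks m M (\<omega> v))}) :: real)"
    by (auto simp: indicator_def)
  also have "measure_pmf.expectation ?P \<dots> =
      expect (1 / 2 ^ m) (V \<times> {..<M}) (\<lambda>T. of_bool (Q {x \<in> J. h x \<in> T}))"
    by (rule expectation_Pi_pmf_blocks[OF assms(1), where g = "\<lambda>T. of_bool (Q {x \<in> J. h x \<in> T})"])
  also have "\<dots> = expect (1 / 2 ^ m) J (\<lambda>S. of_bool (Q S))"
    using assms by (intro expect_vimage[where g = "\<lambda>S. of_bool (Q S)"]) auto
  finally show ?thesis .
qed

section \<open>Flooding and gathering\<close>

text \<open>
  A flooding message consists of the alarm bit, the sender's coin for the arc in the current trial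
  and the binary value; the state is the triple of round number, value and alarm. A trial takes
  \<open>Suc L\<close> rounds: in the last one neighbours compare their values, and all values are reset.
\<close>

definition dec_value :: "msg \<Rightarrow> nat" where
  "dec_value ms = horner_sum of_bool 2 (drop 2 ms)"

definition flood_out :: "nat \<Rightarrow> nat \<Rightarrow> (node_input \<Rightarrow> nat \<Rightarrow> nat \<Rightarrow> bool) \<Rightarrow> node_input
    \<Rightarrow> nat \<times> nat \<times> bool \<Rightarrow> nat \<Rightarrow> msg" where
  "flood_out K L keep I = (\<lambda>(t, x, b) i. b # keep I i (t div Suc L) # map (bit x) [0..<K])"

text \<open>A value is accepted if the coin of either endpoint keeps the edge. The test
  \<open>t div Suc L < J\<close> stops comparisons after the last trial, when the remaining rounds
  only spread the alarm.\<close>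

definition flood_step :: "nat \<Rightarrow> nat \<Rightarrow> (node_input \<Rightarrow> nat \<Rightarrow> nat \<Rightarrow> bool) \<Rightarrow> node_input
    \<Rightarrow> nat \<times> nat \<times> bool \<Rightarrow> msg list \<Rightarrow> nat \<times> nat \<times> bool" where
  "flood_step J L keep I = (\<lambda>(t, x, b) ms. (Suc t,
     if t mod Suc L = L then ident I
     else Min (insert x {dec_value (ms ! k) | k. k < length ms \<and> (ms ! k ! 1 \<or> keep I k (t div Suc L))}),
     b \<or> (\<exists>k<length ms. ms ! k ! 0) \<or>
       (t mod Suc L = L \<and> t div Suc L < J \<and> (\<exists>k<length ms. dec_value (ms ! k) \<noteq> x))))"

definition flood_state :: "nat \<Rightarrow> nat \<Rightarrow> (node_input \<Rightarrow> nat \<Rightarrow> nat \<Rightarrow> bool) \<Rightarrow> node_input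
    \<Rightarrow> msg list list \<Rightarrow> nat \<times> nat \<times> bool" where
  "flood_state J L keep I = foldl (flood_step J L keep I) (0, ident I, False)"

text \<open>
  Gathering is only used for boundedly many \<open>n\<close>, so unary messages of enormous but constant length do.
\<close>

definition gather_out :: "node_input \<Rightarrow> nat rel \<Rightarrow> msg" where
  "gather_out I K = replicate (prod_encode (ident I, set_encode (prod_encode ` K))) True"

text \<open>The identifier sent along reveals the arc to the neighbour, which the node does not know
  at the start.\<close>

definition gather_step :: "node_input \<Rightarrow> nat rel \<Rightarrow> msg list \<Rightarrow> nat rel" where
  "gather_step I K ms = K \<union> (\<Union>k<length ms. let (u, c) = prod_decode (length (ms ! k))
     in {(ident I, u), (u, ident I)} \<union> prod_decode ` set_decode c)"

definition gather_state :: "node_input \<Rightarrow> msg list list \<Rightarrow> nat rel" where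
  "gather_state I = foldl (gather_step I) {}"

lemma port_to_eq:
  assumes "distinct (P u)" "i < length (P u)"
  shows "port_to P u (P u ! i) = i"
  unfolding port_to_def using assms by (intro the_equality) (auto simp: nth_eq_iff_index_eq)

lemma port_to_in:
  assumes "distinct (P u)" "v \<in> set (P u)"
  shows "port_to P u v < length (P u)" "P u ! port_to P u v = v"
  using assms port_to_eq[of P u] by (auto simp: in_set_conv_nth)

lemma length_history [simp]: "length (history A G P l \<omega> t v) = t"
  by (induction t) auto

lemma dec_value_flood_out:
  assumes "x < 2 ^ K"
  shows "dec_value (flood_out K L keep I (t, x, b) i) = x"
proof -
  have "horner_sum of_bool 2 (map (bit x) [0..<K]) = take_bit K x" by (rule horner_sum_bit_eq_take_bit)
  then show ?thesis using assms by (simp add: dec_value_def flood_out_def take_bit_nat_eq_self)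
qed

section \<open>Flooding and gathering on a fixed network\<close>

locale network =
  fixes G :: "nat pair_pre_digraph" and P :: "nat \<Rightarrow> nat list" and V :: "nat set" and E :: "nat rel"
  assumes V: "V = pverts G" and E: "E = parcs G"
    and finite_V: "finite V" and E_sub: "E \<subseteq> V \<times> V" and sym_E: "sym E"
    and ports: "port_numbering G P"
begin

lemma distinct_P: "v \<in> V \<Longrightarrow> distinct (P v)"
  and set_P: "v \<in> V \<Longrightarrow> set (P v) = {u. (u, v) \<in> E}"
  using ports sym_E by (auto simp: port_numbering_def V E dest: symD)

text \<open>Eliminates messages, ports and histories: the later arguments about flooding rest on
  these recurrences for the value \<open>X\<close> and the alarm \<open>b\<close> alone.\<close>

lemma flood_recurrence:
  fixes \<omega> :: "nat \<Rightarrow> bool list" and l :: nat and keep :: "node_input \<Rightarrow> nat \<Rightarrow> nat \<Rightarrow> bool"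
  defines "I \<equiv> input_of G P l \<omega>"
  defines "kp \<equiv> \<lambda>j u v. keep (I u) (port_to P u v) j"
  assumes alg: "\<And>u H i. u \<in> V \<Longrightarrow> send A (I u) H i = flood_out K L keep (I u) (flood_state J L keep (I u) H) i"
    and small: "\<And>v. v \<in> V \<Longrightarrow> v < 2 ^ K"
  obtains X b where
    "\<And>t v. v \<in> V \<Longrightarrow> flood_state J L keep (I v) (history A G P l \<omega> t v) = (t, X t v, b t v)"
    "\<And>v. v \<in> V \<Longrightarrow> X 0 v = v" "\<And>v. v \<in> V \<Longrightarrow> \<not> b 0 v"
    "\<And>t v. v \<in> V \<Longrightarrow> X (Suc t) v = (if t mod Suc L = L then v
       else Min (insert (X t v) {X t u | u. (u, v) \<in> E \<and> (kp (t div Suc L) u v \<or> kp (t div Suc L) v u)}))"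
    "\<And>t v. v \<in> V \<Longrightarrow> b (Suc t) v \<longleftrightarrow> b t v \<or> (\<exists>u. (u, v) \<in> E \<and> b t u) \<or>
       (t mod Suc L = L \<and> t div Suc L < J \<and> (\<exists>u. (u, v) \<in> E \<and> X t u \<noteq> X t v))"
proof -
  define st where "st t v = flood_state J L keep (I v) (history A G P l \<omega> t v)" for t v
  define X where "X t v = fst (snd (st t v))" for t v
  define b where "b t v = snd (snd (st t v))" for t v
  have fst_st: "fst (st t v) = t" for t v
    by (induction t) (auto simp: st_def flood_state_def flood_step_def case_prod_beta)
  have st: "st t v = (t, X t v, b t v)" for t v
    using fst_st[of t v] by (simp add: X_def b_def prod_eq_iff)
  have ident: "ident (I v) = v" for v by (simp add: I_def input_of_def)
  let ?msg = "\<lambda>t u v. flood_out K L keep (I u) (t, X t u, b t u) (port_to P u v)"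
  have st_Suc: "st (Suc t) v = flood_step J L keep (I v) (t, X t v, b t v) (map (\<lambda>u. ?msg t u v) (P v))"
    if v: "v \<in> V" for t v
  proof -
    have "u \<in> V" if "u \<in> set (P v)" for u using set_P[OF v] that E_sub by auto
    then have "map (\<lambda>u. send A (I u) (history A G P l \<omega> t u) (port_to P u v)) (P v) = map (\<lambda>u. ?msg t u v) (P v)"
      using alg st unfolding st_def by (intro map_cong refl) simp
    moreover have "st (Suc t) v = flood_step J L keep (I v) (st t v)
        (map (\<lambda>u. send A (I u) (history A G P l \<omega> t u) (port_to P u v)) (P v))"
      by (simp add: st_def flood_state_def I_def)
    ultimately have "st (Suc t) v = flood_step J L keep (I v) (st t v) (map (\<lambda>u. ?msg t u v) (P v))"
      by (simp only:)
    then show ?thesis using st by simp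
  qed
  have b_0: "\<not> b 0 v" and X_0: "X 0 v = v" for v
    by (auto simp: b_def X_def st_def flood_state_def ident)
  \<comment> \<open>Decoding is faithful only for values below \<open>2 ^ K\<close>. The recurrence
    is therefore shown under \<open>small_X\<close> first and then used to prove that all values are
    vertices, which discharges the condition.\<close>
  have X_Suc: "X (Suc t) v = (if t mod Suc L = L then v
       else Min (insert (X t v) {X t u | u. (u, v) \<in> E \<and> (kp (t div Suc L) u v \<or> kp (t div Suc L) v u)}))"
    and b_Suc: "b (Suc t) v \<longleftrightarrow> b t v \<or> (\<exists>u. (u, v) \<in> E \<and> b t u) \<or>
       (t mod Suc L = L \<and> t div Suc L < J \<and> (\<exists>u. (u, v) \<in> E \<and> X t u \<noteq> X t v))"
    if v: "v \<in> V" and small_X: "\<And>u. u \<in> V \<Longrightarrow> X t u < 2 ^ K" for t v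
  proof -
    define ms where "ms = map (\<lambda>u. ?msg t u v) (P v)"
    have len: "length ms = length (P v)" by (simp add: ms_def)
    have nb: "P v ! k \<in> V" "(P v ! k, v) \<in> E" "port_to P v (P v ! k) = k" if "k < length ms" for k
      using set_P[OF v] that E_sub nth_mem[of k "P v"] port_to_eq[of P v k, OF distinct_P[OF v]]
      by (auto simp: len)
    have dec: "dec_value (ms ! k) = X t (P v ! k)" if "k < length ms" for k
      using dec_value_flood_out small_X nb(1)[OF that] that by (simp add: ms_def)
    have bits: "ms ! k ! 0 = b t (P v ! k)" "ms ! k ! 1 = kp (t div Suc L) (P v ! k) v" if "k < length ms" for k
      using that by (simp_all add: ms_def flood_out_def kp_def)
    have keep: "keep (I v) k j = kp j v (P v ! k)" if "k < length ms" for k j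
      using nb(3)[OF that] by (simp add: kp_def)
    have ex: "(\<exists>k<length ms. Q (P v ! k)) \<longleftrightarrow> (\<exists>u. (u, v) \<in> E \<and> Q u)" for Q
    proof -
      have "(\<exists>k<length ms. Q (P v ! k)) \<longleftrightarrow> (\<exists>u\<in>set (P v). Q u)"
        unfolding len by (metis in_set_conv_nth)
      then show ?thesis unfolding set_P[OF v] by simp
    qed
    have "{dec_value (ms ! k) | k. k < length ms \<and> (ms ! k ! 1 \<or> keep (I v) k (t div Suc L))} =
        {z. \<exists>k<length ms. (kp (t div Suc L) (P v ! k) v \<or> kp (t div Suc L) v (P v ! k)) \<and> z = X t (P v ! k)}"
    proof (intro Collect_cong iffI)
      fix z assume "\<exists>k. z = dec_value (ms ! k) \<and> k < length ms \<and> (ms ! k ! 1 \<or> keep (I v) k (t div Suc L))"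
      then obtain k where "z = dec_value (ms ! k)" "k < length ms" "ms ! k ! 1 \<or> keep (I v) k (t div Suc L)"
        by blast
      then show "\<exists>k<length ms. (kp (t div Suc L) (P v ! k) v \<or> kp (t div Suc L) v (P v ! k)) \<and> z = X t (P v ! k)"
        using dec bits(2) keep by blast
    next
      fix z assume "\<exists>k<length ms. (kp (t div Suc L) (P v ! k) v \<or> kp (t div Suc L) v (P v ! k)) \<and> z = X t (P v ! k)"
      then obtain k where "k < length ms" "kp (t div Suc L) (P v ! k) v \<or> kp (t div Suc L) v (P v ! k)"
          "z = X t (P v ! k)"
        by blast
      then show "\<exists>k. z = dec_value (ms ! k) \<and> k < length ms \<and> (ms ! k ! 1 \<or> keep (I v) k (t div Suc L))"
        using dec[of k] bits(2)[of k] keep[of k "t div Suc L"] by metis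
    qed
    also have "\<dots> = {X t u | u. (u, v) \<in> E \<and> (kp (t div Suc L) u v \<or> kp (t div Suc L) v u)}"
      unfolding ex[where Q = "\<lambda>u. (kp (t div Suc L) u v \<or> kp (t div Suc L) v u) \<and> z = X t u" for z]
      by blast
    finally show "X (Suc t) v = (if t mod Suc L = L then v
       else Min (insert (X t v) {X t u | u. (u, v) \<in> E \<and> (kp (t div Suc L) u v \<or> kp (t div Suc L) v u)}))"
      unfolding X_def[of "Suc t"] st_Suc[OF v] ms_def[symmetric] flood_step_def by (simp add: ident)
    have "(\<exists>k<length ms. ms ! k ! 0) \<longleftrightarrow> (\<exists>u. (u, v) \<in> E \<and> b t u)"
      using bits(1) ex[of "b t"] by auto
    moreover have "(\<exists>k<length ms. dec_value (ms ! k) \<noteq> X t v) \<longleftrightarrow> (\<exists>u. (u, v) \<in> E \<and> X t u \<noteq> X t v)"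
      using dec ex[of "\<lambda>u. X t u \<noteq> X t v"] by auto
    ultimately show "b (Suc t) v \<longleftrightarrow> b t v \<or> (\<exists>u. (u, v) \<in> E \<and> b t u) \<or>
       (t mod Suc L = L \<and> t div Suc L < J \<and> (\<exists>u. (u, v) \<in> E \<and> X t u \<noteq> X t v))"
      unfolding b_def[of "Suc t"] st_Suc[OF v] ms_def[symmetric] flood_step_def by simp
  qed
  have "X t v \<in> V" if "v \<in> V" for t v
    using that
  proof (induction t arbitrary: v)
    case 0
    then show ?case by (simp add: X_0)
  next
    case (Suc t)
    let ?S = "insert (X t v) {X t u | u. (u, v) \<in> E \<and> (kp (t div Suc L) u v \<or> kp (t div Suc L) v u)}"
    have "?S \<subseteq> V" using Suc E_sub by auto
    moreover have "Min ?S \<in> ?S"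
      using finite_subset[OF \<open>?S \<subseteq> V\<close> finite_V] by (rule Min_in) simp
    ultimately have "Min ?S \<in> V" by blast
    then show ?case using X_Suc[OF Suc.prems] Suc small by simp
  qed
  then have "X t v < 2 ^ K" if "v \<in> V" for t v using small that by blast
  with st X_0 b_0 X_Suc b_Suc show ?thesis
    by (intro that[of X b]) (auto simp: st_def[symmetric])
qed

text \<open>The conjuncts describe a minimum, as attained and as a lower bound. The first matters by
  itself for completeness: a value can only come from a vertex joined to \<open>v\<close> by kept
  arcs.\<close>

lemma flood_phase:
  fixes X :: "nat \<Rightarrow> nat \<Rightarrow> nat" and kp :: "nat \<Rightarrow> nat \<Rightarrow> nat \<Rightarrow> bool"
  assumes X_0: "\<And>v. v \<in> V \<Longrightarrow> X 0 v = v"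
    and X_Suc: "\<And>t v. v \<in> V \<Longrightarrow> X (Suc t) v = (if t mod Suc L = L then v
       else Min (insert (X t v) {X t u | u. (u, v) \<in> E \<and> (kp (t div Suc L) u v \<or> kp (t div Suc L) v u)}))"
    and "v \<in> V" "s \<le> L"
  shows "(X (j * Suc L + s) v, v) \<in> steps {(u, v) \<in> E. kp j u v \<or> kp j v u} s \<and>
    (\<forall>u. (u, v) \<in> steps {(u, v) \<in> E. kp j u v \<or> kp j v u} s \<longrightarrow> X (j * Suc L + s) v \<le> u)"
  using assms(3,4)
proof (induction s arbitrary: v)
  case 0
  \<comment> \<open>For \<open>j > 0\<close> the round before is the comparison round of the
    previous trial, which resets all values.\<close>
  have "X (j * Suc L) v = v"
  proof (cases j)
    case (Suc i)
    then have "j * Suc L = Suc (i * Suc L + L)" by simp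
    moreover have "(i * Suc L + L) mod Suc L = L" by (simp add: mod_mult_self3 del: mult_Suc_right)
    ultimately show ?thesis using X_Suc[OF 0(1), of "i * Suc L + L"] by (simp only: if_True simp_thms)
  qed (use X_0 0 in simp)
  then show ?case by simp
next
  case (Suc s)
  let ?Q = "{(u, v) \<in> E. kp j u v \<or> kp j v u}"
  let ?t = "j * Suc L + s"
  let ?S = "insert (X ?t v) {X ?t u | u. (u, v) \<in> ?Q}"
  have "?t mod Suc L = s" "?t div Suc L = j" using Suc.prems(2) by (simp_all del: mult_Suc_right)
  then have X: "X (j * Suc L + Suc s) v = Min ?S"
    using X_Suc[OF Suc.prems(1), of ?t] Suc.prems(2) by simp
  have IH: "(X ?t u, u) \<in> steps ?Q s" "\<And>w. (w, u) \<in> steps ?Q s \<Longrightarrow> X ?t u \<le> w" if "u \<in> V" for u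
    using Suc.IH[OF that] Suc.prems(2) by auto
  have "{u. (u, v) \<in> ?Q} \<subseteq> V" using E_sub by auto
  then have fin: "finite ?S" using finite_V by (auto simp: setcompr_eq_image intro: finite_subset)
  have "Min ?S \<in> ?S" using fin by (rule Min_in) simp
  then obtain u where u: "Min ?S = X ?t u" "(u, v) \<in> ?Q \<union> Id" by auto
  then have "u \<in> V" using Suc.prems(1) E_sub by auto
  then have 1: "(Min ?S, v) \<in> steps ?Q (Suc s)" using u IH(1)[of u] by (auto simp: steps_Suc)
  have 2: "Min ?S \<le> w" if w: "(w, v) \<in> steps ?Q (Suc s)" for w
  proof -
    obtain u where u: "(w, u) \<in> steps ?Q s" "(u, v) \<in> ?Q \<union> Id"
      using w by (auto simp: steps_Suc)
    then have "u \<in> V" using Suc.prems(1) E_sub by auto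
    have "Min ?S \<le> X ?t u" using fin u(2) by (intro Min_le) auto
    also have "\<dots> \<le> w" using IH(2)[OF \<open>u \<in> V\<close>] u(1) .
    finally show ?thesis .
  qed
  show ?case unfolding X using 1 2 by blast
qed

text \<open>With radius at most \<open>L\<close> in every trial, each value has become the least
  vertex by the comparison round, so neighbours agree.\<close>

lemma flood_sound:
  fixes X :: "nat \<Rightarrow> nat \<Rightarrow> nat" and kp :: "nat \<Rightarrow> nat \<Rightarrow> nat \<Rightarrow> bool" and b :: "nat \<Rightarrow> nat \<Rightarrow> bool"
  assumes X_0: "\<And>v. v \<in> V \<Longrightarrow> X 0 v = v"
    and X_Suc: "\<And>t v. v \<in> V \<Longrightarrow> X (Suc t) v = (if t mod Suc L = L then v
       else Min (insert (X t v) {X t u | u. (u, v) \<in> E \<and> (kp (t div Suc L) u v \<or> kp (t div Suc L) v u)}))"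
    and b_0: "\<And>v. v \<in> V \<Longrightarrow> \<not> b 0 v"
    and b_Suc: "\<And>t v. v \<in> V \<Longrightarrow> b (Suc t) v \<longleftrightarrow> b t v \<or> (\<exists>u. (u, v) \<in> E \<and> b t u) \<or>
       (t mod Suc L = L \<and> t div Suc L < J \<and> (\<exists>u. (u, v) \<in> E \<and> X t u \<noteq> X t v))"
    and near: "\<And>j x y. j < J \<Longrightarrow> x \<in> V \<Longrightarrow> y \<in> V \<Longrightarrow>
       (x, y) \<in> steps {(u, v) \<in> E. kp j u v \<or> kp j v u} L"
    and "v \<in> V"
  shows "\<not> b t v"
  using assms(6)
proof (induction t arbitrary: v)
  case 0
  then show ?case by (rule b_0)
next
  case (Suc t)
  have "X t u = X t v" if uv: "(u, v) \<in> E" and t: "t mod Suc L = L" "t div Suc L < J" for u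
  proof -
    have *: "X t w \<in> V \<and> (\<forall>x\<in>V. X t w \<le> x)" if "w \<in> V" for w
    proof -
      have t': "t div Suc L * Suc L + L = t" using t(1) by (metis div_mult_mod_eq)
      have sub: "{(u, v) \<in> E. kp (t div Suc L) u v \<or> kp (t div Suc L) v u} \<subseteq> V \<times> V"
        using E_sub by auto
      have ph: "(X t w, w) \<in> steps {(u, v) \<in> E. kp (t div Suc L) u v \<or> kp (t div Suc L) v u} L"
        "\<And>x. (x, w) \<in> steps {(u, v) \<in> E. kp (t div Suc L) u v \<or> kp (t div Suc L) v u} L \<Longrightarrow> X t w \<le> x"
        using flood_phase[of X L kp w L "t div Suc L", OF X_0 X_Suc that order_refl] unfolding t' by auto
      have "(w, X t w) \<in> steps {(u, v) \<in> E. kp (t div Suc L) u v \<or> kp (t div Suc L) v u} L"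
        using ph(1) by (rule symD[OF sym_steps, rotated]) (use sym_E in \<open>auto intro!: symI dest: symD\<close>)
      then have "X t w \<in> V" using steps_image_subset[OF sub that] by blast
      then show ?thesis using ph(2) near[OF t(2) _ that] by blast
    qed
    have "u \<in> V" using uv E_sub by auto
    then show ?thesis using *[of u] *[OF Suc.prems] by (meson antisym)
  qed
  moreover have "\<not> b t v" by (rule Suc.IH[OF Suc.prems])
  moreover have "\<not> b t u" if "(u, v) \<in> E" for u using that E_sub by (intro Suc.IH) auto
  ultimately show ?case unfolding b_Suc[OF Suc.prems] by blast
qed

text \<open>Comparisons use all arcs of \<open>E\<close>, not just the kept ones. If none raised the
  alarm, all values would agree, because \<open>E\<close> is connected, and would equal the least
  vertex \<open>m\<close>. But the value \<open>m\<close> only travels along kept arcs, so the trial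
  graph would be connected as well. The alarm then needs at most \<open>D\<close> rounds to reach
  everyone.\<close>

lemma flood_complete:
  fixes X :: "nat \<Rightarrow> nat \<Rightarrow> nat" and kp :: "nat \<Rightarrow> nat \<Rightarrow> nat \<Rightarrow> bool" and b :: "nat \<Rightarrow> nat \<Rightarrow> bool"
  assumes X_0: "\<And>v. v \<in> V \<Longrightarrow> X 0 v = v"
    and X_Suc: "\<And>t v. v \<in> V \<Longrightarrow> X (Suc t) v = (if t mod Suc L = L then v
       else Min (insert (X t v) {X t u | u. (u, v) \<in> E \<and> (kp (t div Suc L) u v \<or> kp (t div Suc L) v u)}))"
    and b_Suc: "\<And>t v. v \<in> V \<Longrightarrow> b (Suc t) v \<longleftrightarrow> b t v \<or> (\<exists>u. (u, v) \<in> E \<and> b t u) \<or>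
       (t mod Suc L = L \<and> t div Suc L < J \<and> (\<exists>u. (u, v) \<in> E \<and> X t u \<noteq> X t v))"
    and far: "j < J" "x \<in> V" "y \<in> V" "(x, y) \<notin> {(u, v) \<in> E. kp j u v \<or> kp j v u}\<^sup>*"
    and walks: "\<And>u v. u \<in> V \<Longrightarrow> v \<in> V \<Longrightarrow> (u, v) \<in> steps E D"
    and "v \<in> V"
  shows "b (J * Suc L + D) v"
proof -
  let ?t = "j * Suc L + L" and ?Q = "{(u, v) \<in> E. kp j u v \<or> kp j v u}"
  have ph: "(X ?t w, w) \<in> steps ?Q L" "\<And>x. (x, w) \<in> steps ?Q L \<Longrightarrow> X ?t w \<le> x" if "w \<in> V" for w
    using flood_phase[of X L kp w L j, OF X_0 X_Suc that order_refl] by auto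
  have symQ: "sym ?Q" using sym_E by (auto intro!: symI dest: symD)
  have subQ: "?Q \<subseteq> V \<times> V" using E_sub by auto
  have X_V: "X ?t w \<in> V" if "w \<in> V" for w
    using symD[OF sym_steps[OF symQ] ph(1)[OF that]] steps_image_subset[OF subQ that] by blast
  have b_t: "\<exists>u\<in>V. b (Suc ?t) u"
  proof (rule ccontr)
    assume no: "\<not> (\<exists>u\<in>V. b (Suc ?t) u)"
    have "?t mod Suc L = L" "?t div Suc L = j" by (simp_all del: mult_Suc_right)
    then have eq: "X ?t u = X ?t w" if "(u, w) \<in> E" for u w
      using no b_Suc[of w ?t] far(1) that E_sub by auto
    have eq': "X ?t u = X ?t w" if "(u, w) \<in> E\<^sup>*" for u w
      using that by (induction rule: rtrancl_induct) (auto dest: eq)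
    define m where "m = Min V"
    have m: "m \<in> V" "\<And>u. u \<in> V \<Longrightarrow> m \<le> u"
      unfolding m_def using finite_V far(2) by (auto intro: Min_in)
    have "X ?t m = m"
      using ph(2)[OF m(1), of m] m(2)[OF X_V[OF m(1)]] by simp
    then have "X ?t w = m" if "w \<in> V" for w
      using eq'[of m w] walks[OF m(1) that] steps_subset_rtrancl[of E D] by auto
    then have mw: "(m, w) \<in> ?Q\<^sup>*" if "w \<in> V" for w
      using ph(1)[OF that] steps_subset_rtrancl[of ?Q L] that by auto
    have "(x, m) \<in> ?Q\<^sup>*" using mw[OF far(2)] sym_rtrancl[OF symQ] by (meson symD)
    then have "(x, y) \<in> ?Q\<^sup>*" using mw[OF far(3)] by (rule rtrancl_trans)
    with far(4) show False by (rule notE)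
  qed
  then obtain u where u: "u \<in> V" "b (Suc ?t) u" by blast
  have mono: "b s w \<Longrightarrow> b (s + k) w" if "w \<in> V" for s k w
    by (induction k) (use b_Suc[OF that] in auto)
  have spread: "b (s + k) w" if "b s u" "(u, w) \<in> steps E k" "w \<in> V" for s k w
    using that(2,3)
  proof (induction k arbitrary: w)
    case 0
    then show ?case using that(1) by simp
  next
    case (Suc k)
    then obtain z where z: "(u, z) \<in> steps E k" "(z, w) \<in> E \<union> Id" by (auto simp: steps_Suc)
    then have "z \<in> V" using E_sub Suc.prems by auto
    then have "b (s + k) z" using z(1) by (intro Suc.IH)
    then show ?case using b_Suc[OF Suc.prems(2), of "s + k"] z(2) by auto
  qed
  have "b (Suc ?t + D) v" using spread[OF u(2) walks[OF u(1) assms(9)] assms(9)] .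
  moreover have "Suc ?t \<le> J * Suc L"
    using far(1) mult_le_mono1[of "Suc j" J "Suc L"] by simp
  then have "Suc ?t + D + (J * Suc L - Suc ?t) = J * Suc L + D" by linarith
  ultimately show ?thesis using mono[OF assms(9), of "Suc ?t + D" "J * Suc L - Suc ?t"] by (simp only:)
qed

text \<open>One round teaches each node its own arcs, and \<open>D\<close> more spread them.
  Messages need to be as prescribed only while the knowledge is a subset of \<open>E\<close>, which
  is an invariant; this later keeps them within the bandwidth.\<close>

lemma gather_history:
  fixes \<omega> :: "nat \<Rightarrow> bool list" and l :: nat
  defines "I \<equiv> input_of G P l \<omega>"
  assumes alg: "\<And>u H i. u \<in> V \<Longrightarrow> gather_state (I u) H \<subseteq> E \<Longrightarrow>
      send A (I u) H i = gather_out (I u) (gather_state (I u) H)"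
    and walks: "\<And>u v. u \<in> V \<Longrightarrow> v \<in> V \<Longrightarrow> (u, v) \<in> steps E D"
    and "v \<in> V"
  shows "gather_state (I v) (history A G P l \<omega> (Suc D) v) = E"
proof -
  define K where "K t v = gather_state (I v) (history A G P l \<omega> t v)" for t v
  have fin: "finite E" using E_sub finite_V by (auto intro: finite_subset)
  have ident: "ident (I v) = v" for v by (simp add: I_def input_of_def)
  have K_0: "K 0 v = {}" for v by (simp add: K_def gather_state_def)
  have K_Suc: "K (Suc t) v = K t v \<union> (\<Union>u\<in>{u. (u, v) \<in> E}. {(v, u), (u, v)} \<union> K t u)"
    if v: "v \<in> V" and sub: "\<And>u. u \<in> V \<Longrightarrow> K t u \<subseteq> E" for t v
  proof -
    let ?m = "\<lambda>u. send A (I u) (history A G P l \<omega> t u) (port_to P u v)"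
    have m: "(let (x, c) = prod_decode (length (?m u)) in {(v, x), (x, v)} \<union> prod_decode ` set_decode c) =
        {(v, u), (u, v)} \<union> K t u" if "(u, v) \<in> E" for u
    proof -
      have u: "u \<in> V" using that E_sub by auto
      have "finite (prod_encode ` K t u)" using sub[OF u] fin by (auto intro: finite_subset)
      moreover have "?m u = gather_out (I u) (K t u)"
        using alg[OF u] sub[OF u] unfolding K_def by blast
      ultimately show ?thesis
        by (simp add: gather_out_def ident set_encode_inverse image_image)
    qed
    have "K (Suc t) v = gather_step (I v) (K t v) (map ?m (P v))"
      by (simp add: K_def gather_state_def I_def)
    also have "\<dots> = K t v \<union> (\<Union>u\<in>set (P v). let (x, c) = prod_decode (length (?m u))
        in {(v, x), (x, v)} \<union> prod_decode ` set_decode c)"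
      unfolding gather_step_def set_conv_nth ident by (auto simp: Let_def)
    also have "\<dots> = K t v \<union> (\<Union>u\<in>{u. (u, v) \<in> E}. {(v, u), (u, v)} \<union> K t u)"
      unfolding set_P[OF v] using m by simp
    finally show ?thesis .
  qed
  have sub: "K t v \<subseteq> E" if "v \<in> V" for t v
    using that
  proof (induction t arbitrary: v)
    case (Suc t)
    have "K t u \<subseteq> E" "(v, u) \<in> E" if "(u, v) \<in> E" for u
      using that E_sub Suc.IH symD[OF sym_E that] by auto
    moreover have "K t v \<subseteq> E" by (rule Suc.IH[OF Suc.prems])
    moreover have "K (Suc t) v = K t v \<union> (\<Union>u\<in>{u. (u, v) \<in> E}. {(v, u), (u, v)} \<union> K t u)"
      using Suc.prems Suc.IH by (rule K_Suc)
    ultimately show ?case by auto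
  qed (simp add: K_0)
  note K_Suc = K_Suc[OF _ sub]
  have reach: "(u, w) \<in> K (Suc t) v" if "(u, v) \<in> steps E t" "(u, w) \<in> E" "v \<in> V" for t u v w
    using that(1,3)
  proof (induction t arbitrary: v)
    case 0
    then show ?case using that(2) sym_E by (auto simp: K_Suc dest: symD)
  next
    case (Suc t)
    then obtain z where z: "(u, z) \<in> steps E t" "(z, v) \<in> E \<union> Id" by (auto simp: steps_Suc)
    then have "z \<in> V" using E_sub Suc.prems by auto
    then have "(u, w) \<in> K (Suc t) z" using z(1) by (intro Suc.IH)
    then show ?case using z(2) by (subst K_Suc[OF Suc.prems(2)]) auto
  qed
  have "E \<subseteq> K (Suc D) v"
    using reach walks[OF _ assms(4)] assms(4) E_sub by auto
  then show ?thesis using sub[OF assms(4)] unfolding K_def by blast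
qed

end

section \<open>Cuts and the diameter\<close>

lemma connected_iff:
  assumes "parcs H \<subseteq> pverts H \<times> pverts H" "sym (parcs H)"
  shows "Digraph_Component.connected (with_proj H) \<longleftrightarrow>
    pverts H \<noteq> {} \<and> (\<forall>u\<in>pverts H. \<forall>v\<in>pverts H. (u, v) \<in> (parcs H)\<^sup>*)"
proof -
  have "parcs (mk_symmetric (with_proj H)) = parcs H"
    using assms(2) by (auto simp: parcs_mk_symmetric dest: symD)
  moreover have "(u, v) \<in> rtrancl_on (pverts H) (parcs H) \<longleftrightarrow> (u, v) \<in> (parcs H)\<^sup>*"
    if "u \<in> pverts H" "v \<in> pverts H" for u v
  proof
    assume "(u, v) \<in> (parcs H)\<^sup>*"
    then show "(u, v) \<in> rtrancl_on (pverts H) (parcs H)"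
      using that by (rule rtrancl_consistent_rtrancl_on) (use assms(1) in auto)
  qed (rule rtrancl_on_rtranclI)
  ultimately have "reachable (with_proj (mk_symmetric (with_proj H))) u v \<longleftrightarrow> (u, v) \<in> (parcs H)\<^sup>*"
    if "u \<in> pverts H" "v \<in> pverts H" for u v
    using that by (simp add: reachable_def)
  then show ?thesis by (simp add: Digraph_Component.connected_def strongly_connected_def)
qed

lemma pair_graph_props:
  assumes "pair_graph G"
  shows "finite (pverts G)" "parcs G \<subseteq> pverts G \<times> pverts G" "sym (parcs G)" "\<And>v. (v, v) \<notin> parcs G"
proof -
  interpret pair_graph G by fact
  show "finite (pverts G)" by (rule pair_finite_verts)
  show "parcs G \<subseteq> pverts G \<times> pverts G" using in_arcsD1 in_arcsD2 by auto
  show "sym (parcs G)" using pair_sym_arcs by (simp add: symmetric_def)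
  show "(v, v) \<notin> parcs G" for v using pair_no_loops by force
qed

lemma diameter_steps:
  assumes "pair_graph G" "graph_diameter G \<le> ereal (real D)" "u \<in> pverts G" "v \<in> pverts G"
  shows "(u, v) \<in> steps (parcs G) D"
proof -
  interpret pair_graph G by fact
  have "\<mu> (\<lambda>_. 1) u v \<le> graph_diameter G"
    unfolding graph_diameter_def using assms(3,4)
    by (intro SUP_upper2[of "(u, v)"]) auto
  also have "\<dots> \<le> ereal (real D)" by fact
  \<comment> \<open>The distance is an infimum over walks, so a strict bound is needed to obtain a
    walk; being an integer, its length is still at most \<open>D\<close>.\<close>
  also have "\<dots> < ereal (real D + 1)" by simp
  finally obtain p where p: "awalk u p v" "awalk_cost (\<lambda>_. 1) p < real D + 1"
    unfolding \<mu>_def by (auto simp: INF_less_iff)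
  have "awalk_cost (\<lambda>_. 1) p = real (length p)" by (induction p) auto
  then have len: "length p \<le> D" using p(2) by simp
  have "(u, v) \<in> steps (parcs G) (length p)" using p(1)
  proof (induction p arbitrary: u)
    case Nil
    then show ?case by (simp add: awalk_def)
  next
    case (Cons e p)
    then have e: "e \<in> parcs G" "u = fst e" "awalk (snd e) p v" by (auto simp: awalk_Cons_iff)
    have "(u, snd e) \<in> steps (parcs G) 1" using e by auto
    then show ?case using steps_trans[OF _ Cons.IH[OF e(3)], of u 1] by simp
  qed
  then show ?thesis using steps_mono[OF order_refl len] by blast
qed

section \<open>Deleting undirected edges versus cuts of arcs\<close>

lemma delete_uedges_simps [simp]:
  "pverts (delete_uedges G F) = pverts G"
  "parcs (delete_uedges G F) = {(u, v) \<in> parcs G. {u, v} \<notin> F}"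
  by (simp_all add: delete_uedges_def)

lemma connected_delete_uedges_iff:
  assumes "pair_graph G"
  shows "Digraph_Component.connected (with_proj (delete_uedges G F)) \<longleftrightarrow>
    pverts G \<noteq> {} \<and>
    (\<forall>u\<in>pverts G. \<forall>v\<in>pverts G. (u, v) \<in> {(u, v) \<in> parcs G. {u, v} \<notin> F}\<^sup>*)"
proof -
  have "parcs (delete_uedges G F) \<subseteq> pverts (delete_uedges G F) \<times> pverts (delete_uedges G F)"
    using pair_graph_props(2)[OF assms] by auto
  moreover have "sym (parcs (delete_uedges G F))"
    using pair_graph_props(3)[OF assms] by (auto intro!: symI dest: symD simp: insert_commute)
  ultimately show ?thesis by (simp add: connected_iff)
qed

lemma finite_uedges:
  assumes "pair_graph G"
  shows "finite (uedges G)"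
proof -
  have "uedges G \<subseteq> Pow (pverts G)" using pair_graph_props(2)[OF assms] by (auto simp: uedges_def)
  then show ?thesis using pair_graph_props(1)[OF assms] finite_subset by blast
qed

text \<open>Fewer than \<open>l\<close> arcs leaving \<open>U\<close> would lie on fewer than
  \<open>l\<close> edges, and deleting these cuts \<open>U\<close> off.\<close>

lemma edge_connected_cut:
  assumes "pair_graph G" "edge_connected l G" "U \<noteq> {}" "U \<subset> pverts G"
  shows "l \<le> card (parcs G \<inter> U \<times> (- U))"
proof (rule ccontr)
  assume less: "\<not> l \<le> card (parcs G \<inter> U \<times> (- U))"
  let ?F = "(\<lambda>(u, w). {u, w}) ` (parcs G \<inter> U \<times> (- U))"
  have "finite (parcs G)" using pair_graph_props(1,2)[OF assms(1)] by (auto intro: finite_subset)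
  then have "card ?F < l" using less card_image_le[of "parcs G \<inter> U \<times> (- U)" "\<lambda>(u, w). {u, w}"] by simp
  moreover have "?F \<subseteq> uedges G" by (auto simp: uedges_def)
  ultimately have "Digraph_Component.connected (with_proj (delete_uedges G ?F))"
    using assms(2) by (simp add: edge_connected_def)
  then have conn: "(u, w) \<in> {(u, v) \<in> parcs G. {u, v} \<notin> ?F}\<^sup>*" if "u \<in> pverts G" "w \<in> pverts G" for u w
    using that unfolding connected_delete_uedges_iff[OF assms(1)] by blast
  obtain u w where uw: "u \<in> U" "w \<in> pverts G" "w \<notin> U" using assms(3,4) by blast
  have "w \<in> U" if "(u, w) \<in> {(u, v) \<in> parcs G. {u, v} \<notin> ?F}\<^sup>*" for w
    using that
  proof (induction rule: rtrancl_induct)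
    case (step y z)
    show ?case
    proof (rule ccontr)
      assume "z \<notin> U"
      then have "(y, z) \<in> parcs G \<inter> U \<times> (- U)" using step by auto
      then have "{y, z} \<in> ?F" by force
      then show False using step by auto
    qed
  qed (rule uw)
  then show False using conn[of u w] uw assms(4) by auto
qed

text \<open>Deleting all edges separates two vertices, so the \<open>LEAST\<close> ranges over a
  nonempty set.\<close>

lemma edge_connectivity_witness:
  assumes "pair_graph G" "2 \<le> card (pverts G)"
  obtains F where "F \<subseteq> uedges G" "card F = edge_connectivity G"
    "\<not> Digraph_Component.connected (with_proj (delete_uedges G F))"
proof -
  obtain u v where uv: "u \<in> pverts G" "v \<in> pverts G" "u \<noteq> v"
  proof -
    obtain S where "S \<subseteq> pverts G" "card S = 2"
      using obtain_subset_with_card_n[OF assms(2)] by metis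
    then show ?thesis using that by (auto simp: card_2_iff)
  qed
  have empty: "{(u, v) \<in> parcs G. {u, v} \<notin> uedges G} = {}" by (auto simp: uedges_def)
  have "(u, v) \<notin> {(u, v) \<in> parcs G. {u, v} \<notin> uedges G}\<^sup>*" unfolding empty using uv by simp
  then have "\<not> Digraph_Component.connected (with_proj (delete_uedges G (uedges G)))"
    unfolding connected_delete_uedges_iff[OF assms(1)] using uv by blast
  then have "\<exists>k. \<exists>F. F \<subseteq> uedges G \<and> card F = k \<and>
      \<not> Digraph_Component.connected (with_proj (delete_uedges G F))" by blast
  from LeastI_ex[OF this] show ?thesis
    unfolding edge_connectivity_def[symmetric] using that by blast
qed

lemma edge_connected_le_connectivity:
  assumes "pair_graph G" "edge_connected l G"
  shows "l \<le> edge_connectivity G"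
proof -
  have "2 \<le> card (pverts G)" using assms(2) by (simp add: edge_connected_def)
  from edge_connectivity_witness[OF assms(1) this] obtain F where
    "F \<subseteq> uedges G" "card F = edge_connectivity G"
    "\<not> Digraph_Component.connected (with_proj (delete_uedges G F))" .
  then show ?thesis using assms(2) by (metis edge_connected_def not_le)
qed

text \<open>Coins belong to arcs, so missing a cut means missing both directions of each of its
  edges.\<close>

lemma card_cut_arcs:
  assumes "pair_graph G" "F \<subseteq> uedges G"
  shows "card {(u, v) \<in> parcs G. {u, v} \<in> F} \<le> 2 * card F"
proof -
  have fin: "finite F" using assms finite_uedges finite_subset by blast
  have "{(u, v) \<in> parcs G. {u, v} \<in> F} = (\<Union>e\<in>F. {(u, v) \<in> parcs G. {u, v} = e})" by auto
  also have "card \<dots> \<le> (\<Sum>e\<in>F. card {(u, v) \<in> parcs G. {u, v} = e})"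
    using fin by (rule card_UN_le)
  also have "\<dots> \<le> (\<Sum>e\<in>F. 2)"
  proof (rule sum_mono)
    fix e assume "e \<in> F"
    then obtain x y where e: "e = {x, y}" using assms(2) by (auto simp: uedges_def)
    have "{(u, v) \<in> parcs G. {u, v} = e} \<subseteq> {(x, y), (y, x)}"
      using pair_graph_props(4)[OF assms(1)] by (auto simp: e doubleton_eq_iff)
    then have "card {(u, v) \<in> parcs G. {u, v} = e} \<le> card {(x, y), (y, x)}"
      by (intro card_mono) auto
    also have "\<dots> \<le> 2" by (cases "x = y") auto
    finally show "card {(u, v) \<in> parcs G. {u, v} = e} \<le> 2" .
  qed
  finally show ?thesis by (simp add: mult.commute)
qed

section \<open>Choice of parameters\<close>

definition nbits :: "nat \<Rightarrow> nat" where "nbits n = nat \<lceil>log 2 (real n)\<rceil>"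

text \<open>Rounding makes the sampling probability \<open>1 / 2 ^ lexp l\<close> a power of 1/2
  that is at least \<open>1 / l\<close> and less than \<open>2 / l\<close>.\<close>

definition lexp :: "nat \<Rightarrow> nat" where "lexp l = nat \<lfloor>log 2 (real l)\<rfloor>"

lemma nbits_props:
  assumes "3 \<le> n"
  shows "1 \<le> log 2 (real n)" "n \<le> 2 ^ nbits n" "real (nbits n) \<le> 2 * log 2 (real n)" "1 \<le> nbits n"
proof -
  have "log 2 2 \<le> log 2 (real n)" using assms by (subst log_le_cancel_iff) auto
  then show 1: "1 \<le> log 2 (real n)" by simp
  have b: "log 2 (real n) \<le> real (nbits n)" "real (nbits n) < log 2 (real n) + 1"
    unfolding nbits_def using 1 by linarith+
  have "real n = 2 powr log 2 (real n)" using assms by simp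
  also have "\<dots> \<le> 2 powr real (nbits n)" using b by (intro powr_mono) auto
  also have "\<dots> = real (2 ^ nbits n)" by (simp add: powr_realpow)
  finally show "n \<le> 2 ^ nbits n" by (simp only: of_nat_le_iff)
  show "real (nbits n) \<le> 2 * log 2 (real n)" using b 1 by simp
  show "1 \<le> nbits n" using b 1 by linarith
qed

lemma lexp_props:
  assumes "2 \<le> l"
  shows "1 \<le> lexp l" "2 ^ lexp l \<le> l" "l < 2 * 2 ^ lexp l"
proof -
  have "log 2 2 \<le> log 2 (real l)" using assms by (subst log_le_cancel_iff) auto
  then have 1: "1 \<le> log 2 (real l)" by simp
  have m: "real (lexp l) \<le> log 2 (real l)" "log 2 (real l) < real (lexp l) + 1"
    unfolding lexp_def using 1 by linarith+
  then show "1 \<le> lexp l" using 1 by linarith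
  have l: "2 powr log 2 (real l) = real l" using assms by simp
  have "real (2 ^ lexp l) = 2 powr real (lexp l)" by (simp add: powr_realpow)
  also have "\<dots> \<le> real l" using m(1) l by (metis one_less_numeral_iff powr_le_cancel_iff semiring_norm(76))
  finally show "2 ^ lexp l \<le> l" by (simp only: of_nat_le_iff)
  have "real l < 2 powr (real (lexp l) + 1)"
    using m(2) l by (metis one_less_numeral_iff powr_less_cancel_iff semiring_norm(76))
  also have "\<dots> = real (2 * 2 ^ lexp l)" by (simp add: powr_realpow powr_add)
  finally show "l < 2 * 2 ^ lexp l" by (simp only: of_nat_less_iff)
qed

lemma pow_sample_le_half: "(1 - 1 / 2 ^ m :: real) ^ (2 ^ m) \<le> 1 / 2"
proof -
  have "(1 - 1 / 2 ^ m :: real) ^ (2 ^ m) \<le> exp (- (1 / 2 ^ m)) ^ (2 ^ m)"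
    using exp_ge_add_one_self[of "- (1 / 2 ^ m)"] by (intro power_mono) auto
  also have "\<dots> = exp (- 1)" by (simp flip: exp_of_nat_mult)
  also have "\<dots> \<le> 1 / 2" using exp_ge_add_one_self[of 1] by (simp add: exp_minus field_simps)
  finally show ?thesis .
qed

text \<open>Bernoulli's inequality with half the exponent gives 1/2, and squaring gives 1/4. For
  \<open>m = 0\<close> the power would be 0.\<close>

lemma pow_sample_ge_quarter:
  assumes "1 \<le> m"
  shows "1 / 4 \<le> (1 - 1 / 2 ^ m :: real) ^ (2 ^ m)"
proof -
  obtain k where m: "m = Suc k" using assms by (cases m) auto
  have "- 1 \<le> - (1 / 2 ^ m :: real)" by simp
  from Bernoulli_inequality[OF this, of "2 ^ k"]
  have "1 / 2 \<le> (1 - 1 / 2 ^ m :: real) ^ (2 ^ k)" by (simp add: m)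
  then have "(1 / 2) ^ 2 \<le> ((1 - 1 / 2 ^ m :: real) ^ (2 ^ k)) ^ 2" by (intro power_mono) auto
  then show ?thesis by (simp add: m power_mult[symmetric] mult.commute power_divide)
qed

lemma square_le_two_power: "4 \<le> b \<Longrightarrow> b * b \<le> (2::nat) ^ b"
proof (induction b rule: nat_induct_at_least)
  case (Suc b)
  have "Suc b * Suc b = b * b + 2 * b + 1" by simp
  also have "\<dots> \<le> b * b + b * b"
  proof -
    have "4 * b \<le> b * b" using Suc.hyps by (intro mult_le_mono1)
    then show ?thesis using Suc.hyps by linarith
  qed
  also have "\<dots> \<le> 2 ^ Suc b" using Suc.IH by simp
  finally show ?case .
qed simp

text \<open>
  A cut of \<open>k \<le> l / log 2 n\<close> edges has at most \<open>2 k * Suc (levels n) \<le> 80 * 2 ^ lexp l\<close> coins in a trial,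
  which all fail with probability at least \<open>(1 / 4) ^ 80\<close>.
\<close>

definition trial_factor :: nat where "trial_factor = 2 ^ 160"

definition trials :: "nat \<Rightarrow> nat" where "trials n = trial_factor * nbits n"

text \<open>The 9 here and the 3 in \<open>walk_bound\<close> both make the corresponding failure
  term at most \<open>(1 / 2) ^ (3 * nbits n)\<close>, the former by
  \<open>(3 / 4) ^ 3 \<le> 1 / 2\<close>.\<close>

definition levels :: "nat \<Rightarrow> nat" where "levels n = 9 * nbits n"

definition walk_bound :: "nat \<Rightarrow> nat \<Rightarrow> nat" where "walk_bound n l = 3 * nbits n * 2 ^ lexp l"

definition radius :: "nat \<Rightarrow> nat \<Rightarrow> nat \<Rightarrow> nat" where
  "radius D n l = (2 * walk_bound n l + 3) ^ D - 1"

text \<open>Of the three factors \<open>(1 / 2) ^ nbits n\<close>, one pays for the union over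
  \<open>n\<close> vertices, one for the trials and the \<open>D\<close> layers by the last
  assumption, and one remains as the failure probability.\<close>

lemma failure_bound:
  assumes "3 \<le> n" "2 \<le> l" "trial_factor * (1 + D) * nbits n \<le> 2 ^ nbits n"
  shows "real (trials n) * ((3 / 4) ^ levels n * real n +
      real D * (real n * (1 - 1 / 2 ^ lexp l) ^ walk_bound n l)) \<le> 1 / real n"
proof -
  let ?b = "nbits n"
  have n: "real n \<le> 2 ^ ?b" using nbits_props(2)[OF assms(1)] by (metis of_nat_le_iff of_nat_numeral of_nat_power)
  have "(3 / 4 :: real) ^ levels n = ((3 / 4) ^ 3) ^ (3 * ?b)"
    by (simp add: levels_def flip: power_mult)
  also have "\<dots> \<le> (1 / 2) ^ (3 * ?b)" by (intro power_mono) (simp_all add: power3_eq_cube)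
  finally have 1: "(3 / 4 :: real) ^ levels n \<le> (1 / 2) ^ (3 * ?b)" .
  have "(1 - 1 / 2 ^ lexp l :: real) ^ walk_bound n l = ((1 - 1 / 2 ^ lexp l) ^ (2 ^ lexp l)) ^ (3 * ?b)"
    by (simp add: walk_bound_def mult.commute flip: power_mult)
  also have "\<dots> \<le> (1 / 2) ^ (3 * ?b)" by (intro power_mono pow_sample_le_half) auto
  finally have 2: "(1 - 1 / 2 ^ lexp l :: real) ^ walk_bound n l \<le> (1 / 2) ^ (3 * ?b)" .
  have "(3 / 4) ^ levels n * real n + real D * (real n * (1 - 1 / 2 ^ lexp l) ^ walk_bound n l)
      \<le> (1 / 2) ^ (3 * ?b) * 2 ^ ?b + real D * (2 ^ ?b * (1 / 2) ^ (3 * ?b))"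
    using n 1 2 by (intro add_mono mult_mono) auto
  also have "\<dots> = (1 + real D) * (1 / 2) ^ (2 * ?b)"
  proof -
    have "(1 / 2 :: real) ^ (3 * ?b) * 2 ^ ?b = (1 / 2) ^ (2 * ?b) * ((1 / 2) ^ ?b * 2 ^ ?b)"
      by (simp add: power_add[symmetric])
    also have "\<dots> = (1 / 2) ^ (2 * ?b)" by (simp flip: power_mult_distrib)
    finally show ?thesis by (simp add: algebra_simps)
  qed
  finally have "real (trials n) * ((3 / 4) ^ levels n * real n +
      real D * (real n * (1 - 1 / 2 ^ lexp l) ^ walk_bound n l)) \<le>
      real (trials n) * ((1 + real D) * (1 / 2) ^ (2 * ?b))" by (intro mult_left_mono) auto
  also have "\<dots> = real (trial_factor * (1 + D) * nbits n) * (1 / 2) ^ (2 * ?b)"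
    by (simp add: trials_def algebra_simps)
  also have "\<dots> \<le> real (2 ^ ?b) * (1 / 2) ^ (2 * ?b)"
    using assms(3) by (intro mult_right_mono) (simp_all only: of_nat_le_iff, simp)
  also have "\<dots> = 1 / 2 ^ ?b" by (simp add: power_one_over power_mult power2_eq_square mult.commute[of 2] power_mult_distrib)
  also have "\<dots> \<le> 1 / real n" using n assms(1) by (intro divide_left_mono) auto
  finally show ?thesis .
qed

lemma detection_bound:
  assumes "3 \<le> n" "2 \<le> l" "real k \<le> real l / log 2 (real n)" "f \<le> 2 * k"
  shows "(1 - (1 - 1 / 2 ^ lexp l) ^ (f * Suc (levels n)) :: real) ^ trials n \<le> 1 / real n"
proof -
  let ?b = "nbits n" and ?q = "1 - 1 / 2 ^ lexp l :: real"
  have n: "real n \<le> 2 ^ ?b" using nbits_props(2)[OF assms(1)] by (metis of_nat_le_iff of_nat_numeral of_nat_power)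
  have q: "0 \<le> ?q" "?q \<le> 1" by auto
  have "real (f * Suc (levels n)) \<le> 2 * real k * (10 * real ?b)"
  proof -
    have "Suc (levels n) \<le> 10 * ?b" using nbits_props(4)[OF assms(1)] by (simp add: levels_def)
    then have "f * Suc (levels n) \<le> (2 * k) * (10 * ?b)" using assms(4) by (intro mult_le_mono)
    then have "real (f * Suc (levels n)) \<le> real ((2 * k) * (10 * ?b))" by (simp only: of_nat_le_iff)
    then show ?thesis by simp
  qed
  also have "\<dots> \<le> 2 * (real l / log 2 (real n)) * (10 * (2 * log 2 (real n)))"
    using assms(3) nbits_props(1,3)[OF assms(1)] by (intro mult_mono) auto
  also have "\<dots> = 40 * real l" using nbits_props(1)[OF assms(1)] by simp
  also have "\<dots> \<le> 80 * real (2 ^ lexp l)" using lexp_props(3)[OF assms(2)] by linarith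
  finally have e: "f * Suc (levels n) \<le> 2 ^ lexp l * 80" by linarith
  have "1 / real trial_factor = (1 / 4) ^ 80" by (simp add: trial_factor_def power_one_over)
  also have "\<dots> \<le> (?q ^ (2 ^ lexp l)) ^ 80"
    using pow_sample_ge_quarter[OF lexp_props(1)[OF assms(2)]] by (intro power_mono) auto
  also have "\<dots> = ?q ^ (2 ^ lexp l * 80)" by (simp only: power_mult)
  also have "\<dots> \<le> ?q ^ (f * Suc (levels n))" using q e by (intro power_decreasing)
  finally have "(1 - ?q ^ (f * Suc (levels n))) ^ trials n \<le> (1 - 1 / real trial_factor) ^ trials n"
    using q by (intro power_mono) (auto intro: power_le_one)
  \<comment> \<open>\<open>trial_factor\<close> is itself a power of two, so each group of
    \<open>2 ^ 160\<close> trials fails with probability at most 1/2 by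
    \<open>pow_sample_le_half\<close>.\<close>
  also have "\<dots> = ((1 - 1 / 2 ^ 160) ^ (2 ^ 160)) ^ ?b"
    unfolding trials_def power_mult by (simp only: trial_factor_def of_nat_power of_nat_numeral)
  also have "\<dots> \<le> (1 / 2) ^ ?b" by (intro power_mono pow_sample_le_half zero_le_power) simp
  also have "\<dots> \<le> 1 / real n" using n assms(1) by (simp add: power_one_over field_simps)
  finally show ?thesis .
qed

lemma round_bound:
  assumes "3 \<le> n" "2 \<le> l"
  defines "x \<equiv> real l * log 2 (real n)"
  shows "real (trials n * Suc (radius D n l) + D) \<le> (2 * real trial_factor * 15 ^ D + real D) * x ^ Suc D"
    and "1 \<le> x"
proof -
  have lg: "1 \<le> log 2 (real n)" and b: "real (nbits n) \<le> 2 * log 2 (real n)"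
    using nbits_props[OF assms(1)] by auto
  have "1 * 1 \<le> real l * log 2 (real n)" using lg assms(2) by (intro mult_mono) auto
  then show x1: "1 \<le> x" by (simp add: x_def)
  have "1 * log 2 (real n) \<le> real l * log 2 (real n)" using lg assms(2) by (intro mult_right_mono) auto
  then have bx: "real (nbits n) \<le> 2 * x" using b by (simp add: x_def)
  have "real (nbits n) * real (2 ^ lexp l) \<le> (2 * log 2 (real n)) * real l"
  proof -
    have "real (2 ^ lexp l) \<le> real l" using lexp_props(2)[OF assms(2)] by (simp only: of_nat_le_iff)
    then show ?thesis using b lg by (intro mult_mono) auto
  qed
  then have bl: "real (nbits n) * real (2 ^ lexp l) \<le> 2 * x"
    unfolding x_def by (simp only: mult_ac)
  \<comment> \<open>\<open>walk_bound n l\<close> is at most \<open>6 * x\<close>, and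
    \<open>3 \<le> 3 * x\<close>.\<close>
  have w: "2 * real (walk_bound n l) + 3 \<le> 15 * x"
  proof -
    have "real (walk_bound n l) = 3 * (real (nbits n) * real (2 ^ lexp l))"
      by (simp add: walk_bound_def)
    then show ?thesis using x1 bl by linarith
  qed
  have "real (Suc (radius D n l)) = (2 * real (walk_bound n l) + 3) ^ D"
    by (simp add: radius_def of_nat_diff add.commute)
  also have "\<dots> \<le> (15 * x) ^ D" using w by (intro power_mono) auto
  finally have r: "real (Suc (radius D n l)) \<le> (15 * x) ^ D" .
  have "real (trials n * Suc (radius D n l)) \<le> (real trial_factor * (2 * x)) * (15 * x) ^ D"
    unfolding of_nat_mult trials_def using r bx x1 by (intro mult_mono) auto
  also have "\<dots> = 2 * real trial_factor * 15 ^ D * x ^ Suc D" by (simp add: power_mult_distrib)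
  finally have "real (trials n * Suc (radius D n l)) \<le> 2 * real trial_factor * 15 ^ D * x ^ Suc D" .
  moreover have "real D * 1 \<le> real D * x ^ Suc D" using x1 by (intro mult_left_mono one_le_power) auto
  ultimately show "real (trials n * Suc (radius D n l) + D) \<le> (2 * real trial_factor * 15 ^ D + real D) * x ^ Suc D"
    by (simp add: distrib_right)
qed

section \<open>The verification algorithm\<close>

definition coin_index :: "nat \<Rightarrow> nat \<Rightarrow> nat \<Rightarrow> nat" where
  "coin_index i j r = prod_encode (i, prod_encode (j, r))"

lemma coin_index_inject [simp]: "coin_index i j r = coin_index i' j' r' \<longleftrightarrow> i = i' \<and> j = j' \<and> r = r'"
  by (simp add: coin_index_def prod_encode_eq)

text \<open>The number of bits may depend on \<open>n\<close> and \<open>l\<close> only, so it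
  provides for \<open>n\<close> ports at every node, whatever its degree.\<close>

definition num_blocks :: "nat \<Rightarrow> nat" where
  "num_blocks n = Suc (Max ((\<lambda>(i, j, r). coin_index i j r) ` ({..<n} \<times> {..<trials n} \<times> {..levels n})))"

lemma coin_index_less:
  assumes "i < n" "j < trials n" "r \<le> levels n"
  shows "coin_index i j r < num_blocks n"
proof -
  have "coin_index i j r \<in> (\<lambda>(i, j, r). coin_index i j r) ` ({..<n} \<times> {..<trials n} \<times> {..levels n})"
    using assms by (intro image_eqI[of _ _ "(i, j, r)"]) auto
  then show ?thesis unfolding num_blocks_def by (intro le_imp_less_Suc Max_ge) auto
qed

definition keep_port :: "node_input \<Rightarrow> nat \<Rightarrow> nat \<Rightarrow> bool" where
  "keep_port I i j \<longleftrightarrow> (\<exists>r\<le>levels (num_nodes I).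
     coin_index i j r \<in> blocks (lexp (param I)) (num_blocks (num_nodes I)) (coins I))"

text \<open>
  The guard on the message length, which never takes effect when \<open>n \<ge> 3\<close> and the identifiers are
  less than \<open>n ^ a\<close>, makes the bandwidth bound hold for arbitrary inputs and histories.
\<close>

definition verifier :: "nat \<Rightarrow> nat \<Rightarrow> nat \<Rightarrow> nat \<Rightarrow> congest_algorithm" where
  "verifier D a N B = \<lparr>num_coins = (\<lambda>n l. num_blocks n * lexp l),
     send = (\<lambda>I H i.
       let n = num_nodes I; L = radius D n (param I);
         m = (if n < N then gather_out I (gather_state I H)
              else flood_out (a * nbits n) L keep_port I (flood_state (trials n) L keep_port I H) i)
       in if real (length m) \<le> real B * log 2 (real n) then m else []),
     verdict = (\<lambda>I H.
       let n = num_nodes I; L = radius D n (param I); K = gather_state I H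
       in if param I \<le> 1 then Some True
          else if n < N then
            (if length H = Suc D then Some (edge_connected (param I) \<lparr>pverts = fst ` K, parcs = K\<rparr>) else None)
          else
            (if length H = trials n * Suc L + D
             then Some (\<not> snd (snd (flood_state (trials n) L keep_port I H))) else None))\<rparr>"

lemma congest_bandwidth_verifier: "congest_bandwidth (verifier D a N B) B"
proof -
  have "0 \<le> real B * log 2 (real n)" for n
    by (cases "n = 0") (auto simp: log_def)
  then show ?thesis by (auto simp: congest_bandwidth_def verifier_def Let_def)
qed

lemma outputs_byI:
  assumes "\<And>H. verdict A (input_of G P l \<omega> v) H = (if length H = T then Some (f H) else None)"
  shows "outputs_by A G P l \<omega> T v (f (history A G P l \<omega> T v))"
  unfolding outputs_by_def using assms by (intro exI[of _ T]) auto

lemma kept_iff: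
  "{(u, v) \<in> E. (\<exists>r\<le>R. ((u, v), j, r) \<in> S) \<or> (\<exists>r\<le>R. ((v, u), j, r) \<in> S)} =
    fst ` {(e, r) \<in> E \<times> {..R}. (e, j, r) \<in> S} \<union> (fst ` {(e, r) \<in> E \<times> {..R}. (e, j, r) \<in> S})\<inverse>"
  if "sym E" for E :: "nat rel" and R :: nat and S :: "((nat \<times> nat) \<times> 'j \<times> nat) set"
  using symD[OF that] by (force simp: image_iff)

context network begin

text \<open>The coins reindexed by arc, trial and level. The tail owns the coin of an arc, so the
  two directions of an edge have independent coins.\<close>

definition trial_coins :: "nat \<Rightarrow> (nat \<Rightarrow> bool list) \<Rightarrow> ((nat \<times> nat) \<times> nat \<times> nat) set" where
  "trial_coins l \<omega> = {x \<in> E \<times> {..<trials (card V)} \<times> {..levels (card V)}.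
     (\<lambda>((u, w), j, r). (u, coin_index (port_to P u w) j r)) x
       \<in> (SIGMA v:V. blocks (lexp l) (num_blocks (card V)) (\<omega> v))}"

abbreviation trial_graph :: "nat \<Rightarrow> ((nat \<times> nat) \<times> nat \<times> nat) set \<Rightarrow> nat rel" where
  "trial_graph j S \<equiv> fst ` {(e, r) \<in> E \<times> {..levels (card V)}. (e, j, r) \<in> S} \<union>
     (fst ` {(e, r) \<in> E \<times> {..levels (card V)}. (e, j, r) \<in> S})\<inverse>"

lemma port_less_card:
  assumes "(u, w) \<in> E"
  shows "port_to P u w < card V"
proof -
  have u: "u \<in> V" and w: "w \<in> set (P u)" using assms E_sub set_P[of u] symD[OF sym_E assms] by auto
  have "port_to P u w < length (P u)" using port_to_in(1)[of P u w, OF distinct_P[OF u] w] .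
  also have "\<dots> = card (set (P u))" using distinct_P[OF u] by (simp add: distinct_card)
  also have "\<dots> \<le> card V" using set_P[OF u] E_sub finite_V by (intro card_mono) auto
  finally show ?thesis .
qed

text \<open>Distinct arcs out of \<open>u\<close> have distinct ports and \<open>coin_index\<close>
  is injective, so no two arc coins share a block.\<close>

lemma prob_trial_coins:
  assumes "num_coins A (card V) l = num_blocks (card V) * lexp l"
  shows "measure_pmf.prob (coin_pmf A G l) {\<omega>. Q (trial_coins l \<omega>)} =
    expect (1 / 2 ^ lexp l) (E \<times> {..<trials (card V)} \<times> {..levels (card V)}) (\<lambda>S. of_bool (Q S))"
  unfolding coin_pmf_def V[symmetric] assms trial_coins_def
proof (rule prob_Pi_pmf_blocks[OF finite_V])
  let ?h = "\<lambda>((u, w), j, r). (u, coin_index (port_to P u w) j r)"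
  let ?X = "E \<times> {..<trials (card V)} \<times> {..levels (card V)}"
  have port_inj: "w = w'" if "(u, w) \<in> E" "(u, w') \<in> E" "port_to P u w = port_to P u w'" for u w w'
  proof -
    have "u \<in> V" "w \<in> set (P u)" "w' \<in> set (P u)"
      using that E_sub set_P[of u] symD[OF sym_E] by auto
    then have "P u ! port_to P u w = w" "P u ! port_to P u w' = w'"
      using port_to_in(2)[of P u] distinct_P by auto
    then show ?thesis unfolding that(3) by (rule box_equals[OF refl])
  qed
  show "inj_on ?h ?X"
  proof (rule inj_onI)
    fix x y assume xy: "x \<in> ?X" "y \<in> ?X" "?h x = ?h y"
    obtain u w j r where x: "x = ((u, w), j, r)" by (metis surj_pair)
    obtain u' w' j' r' where y: "y = ((u', w'), j', r')" by (metis surj_pair)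
    have eq: "u' = u" "j' = j" "r' = r" "port_to P u w = port_to P u w'" using xy(3) unfolding x y by auto
    have "(u, w) \<in> E" "(u, w') \<in> E" using xy(1,2) unfolding x y eq(1) by simp_all
    then have "w = w'" using eq(4) by (rule port_inj)
    with eq(1-3) show "x = y" unfolding x y by simp
  qed
  show "?h ` ?X \<subseteq> V \<times> {..<num_blocks (card V)}"
    using E_sub port_less_card by (auto intro!: coin_index_less)
qed

lemma flood_outcome:
  fixes \<omega> :: "nat \<Rightarrow> bool list"
  assumes "2 \<le> l" "N \<le> card V" "3 \<le> card V" "\<forall>v\<in>V. v < card V ^ a" "2 + 2 * a \<le> B"
    and walks: "\<And>u v. u \<in> V \<Longrightarrow> v \<in> V \<Longrightarrow> (u, v) \<in> steps E D"
  defines "A \<equiv> verifier D a N B" and "n \<equiv> card V" and "L \<equiv> radius D (card V) l"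
  defines "T \<equiv> trials n * Suc L + D"
  shows "\<exists>b. \<forall>v\<in>V. outputs_by A G P l \<omega> T v (b v)"
    and "(\<And>j x y. j < trials n \<Longrightarrow> x \<in> V \<Longrightarrow> y \<in> V \<Longrightarrow> (x, y) \<in> steps (trial_graph j (trial_coins l \<omega>)) L) \<Longrightarrow>
      v \<in> V \<Longrightarrow> outputs_by A G P l \<omega> T v True"
    and "\<And>j x y. j < trials n \<Longrightarrow> x \<in> V \<Longrightarrow> y \<in> V \<Longrightarrow> (x, y) \<notin> (trial_graph j (trial_coins l \<omega>))\<^sup>* \<Longrightarrow>
      v \<in> V \<Longrightarrow> outputs_by A G P l \<omega> T v False"
proof -
  let ?I = "input_of G P l \<omega>" and ?S = "trial_coins l \<omega>" and ?K = "a * nbits n"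
  have I: "num_nodes (?I u) = n" "param (?I u) = l" "coins (?I u) = \<omega> u" for u
    by (simp_all add: input_of_def n_def V)
  have nN: "\<not> n < N" "3 \<le> n" using assms(2,3) by (simp_all add: n_def)
  \<comment> \<open>Origin of \<open>2 + 2 * a\<close>: both 2 and \<open>nbits n\<close> are at
    most \<open>2 * log 2 n\<close>. Hence the length guard lets every flooding message
    pass.\<close>
  have len: "real (2 + ?K) \<le> real B * log 2 (real n)"
  proof -
    have "real (2 + ?K) \<le> 2 * log 2 (real n) + real a * (2 * log 2 (real n))"
      using nbits_props(1,3)[OF nN(2)] by (auto intro!: add_mono mult_left_mono)
    also have "\<dots> = real (2 + 2 * a) * log 2 (real n)" by (simp add: algebra_simps)
    also have "\<dots> \<le> real B * log 2 (real n)"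
    proof (rule mult_right_mono)
      show "real (2 + 2 * a) \<le> real B" using assms(5) by (simp only: of_nat_le_iff)
    qed (use nbits_props(1)[OF nN(2)] in simp)
    finally show ?thesis .
  qed
  have send: "send A (?I u) H i = flood_out ?K L keep_port (?I u) (flood_state (trials n) L keep_port (?I u) H) i"
    for u H i
  proof -
    have "length (flood_out ?K L keep_port (?I u) st i) = 2 + ?K" for st
      by (simp add: flood_out_def case_prod_beta)
    then show ?thesis using len nN(1) by (simp add: A_def verifier_def I Let_def L_def n_def[symmetric])
  qed
  have small: "v < 2 ^ ?K" if "v \<in> V" for v
  proof -
    have "v < n ^ a" using assms(4) that by (simp add: n_def)
    also have "\<dots> \<le> (2 ^ nbits n) ^ a" using nbits_props(2)[OF nN(2)] by (intro power_mono) auto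
    also have "\<dots> = 2 ^ ?K" by (simp add: power_mult[symmetric] mult.commute)
    finally show ?thesis .
  qed
  obtain X b where Xb: "\<And>t v. v \<in> V \<Longrightarrow>
        flood_state (trials n) L keep_port (?I v) (history A G P l \<omega> t v) = (t, X t v, b t v)"
    and X_0: "\<And>v. v \<in> V \<Longrightarrow> X 0 v = v" and b_0: "\<And>v. v \<in> V \<Longrightarrow> \<not> b 0 v"
    and X_Suc: "\<And>t v. v \<in> V \<Longrightarrow> X (Suc t) v = (if t mod Suc L = L then v
       else Min (insert (X t v) {X t u | u. (u, v) \<in> E \<and>
         (keep_port (?I u) (port_to P u v) (t div Suc L) \<or> keep_port (?I v) (port_to P v u) (t div Suc L))}))"
    and b_Suc: "\<And>t v. v \<in> V \<Longrightarrow> b (Suc t) v \<longleftrightarrow> b t v \<or> (\<exists>u. (u, v) \<in> E \<and> b t u) \<or>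
       (t mod Suc L = L \<and> t div Suc L < trials n \<and> (\<exists>u. (u, v) \<in> E \<and> X t u \<noteq> X t v))"
    using flood_recurrence[OF send small] by blast
  let ?kp = "\<lambda>j u v. keep_port (?I u) (port_to P u v) j"
  have kept: "{(u, v) \<in> E. ?kp j u v \<or> ?kp j v u} = trial_graph j ?S" if "j < trials n" for j
  proof -
    have "?kp j u v \<longleftrightarrow> (\<exists>r\<le>levels n. ((u, v), j, r) \<in> ?S)" if "(u, v) \<in> E" for u v
      using \<open>j < trials n\<close> that E_sub by (auto simp: keep_port_def trial_coins_def I n_def)
    then have "{(u, v) \<in> E. ?kp j u v \<or> ?kp j v u} =
        {(u, v) \<in> E. (\<exists>r\<le>levels n. ((u, v), j, r) \<in> ?S) \<or> (\<exists>r\<le>levels n. ((v, u), j, r) \<in> ?S)}"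
      using symD[OF sym_E] by blast
    also have "\<dots> = trial_graph j ?S" unfolding n_def by (rule kept_iff[OF sym_E])
    finally show ?thesis .
  qed
  have out: "outputs_by A G P l \<omega> T v (\<not> b T v)" if "v \<in> V" for v
  proof -
    have "verdict A (?I v) H = (if length H = T
        then Some (\<not> snd (snd (flood_state (trials n) L keep_port (?I v) H))) else None)" for H
      using nN(1) assms(1) by (simp add: A_def verifier_def I Let_def L_def n_def[symmetric] T_def)
    from outputs_byI[OF this] show ?thesis using Xb[OF that] by simp
  qed
  show "\<exists>b. \<forall>v\<in>V. outputs_by A G P l \<omega> T v (b v)"
    by (intro exI[of _ "\<lambda>v. \<not> b T v"] ballI out)
  show "outputs_by A G P l \<omega> T v True"
    if near: "\<And>j x y. j < trials n \<Longrightarrow> x \<in> V \<Longrightarrow> y \<in> V \<Longrightarrow> (x, y) \<in> steps (trial_graph j ?S) L"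
      and v: "v \<in> V"
  proof -
    have near': "(x, y) \<in> steps {(u, v) \<in> E. ?kp j u v \<or> ?kp j v u} L"
      if "j < trials n" "x \<in> V" "y \<in> V" for j x y
      unfolding kept[OF that(1)] using that by (rule near)
    have "\<not> b T v"
      by (rule flood_sound[where kp = ?kp and X = X and b = b and J = "trials n" and L = L,
            OF X_0 X_Suc b_0 b_Suc near' v])
    then show ?thesis using out[OF v] by simp
  qed
  show "outputs_by A G P l \<omega> T v False"
    if far: "j < trials n" "x \<in> V" "y \<in> V" "(x, y) \<notin> (trial_graph j ?S)\<^sup>*" and v: "v \<in> V" for j x y
  proof -
    have far': "(x, y) \<notin> {(u, v) \<in> E. ?kp j u v \<or> ?kp j v u}\<^sup>*"
      unfolding kept[OF far(1)] by (rule far(4))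
    have "b T v" unfolding T_def
      by (rule flood_complete[where kp = ?kp and X = X and b = b and J = "trials n" and L = L,
            OF X_0 X_Suc b_Suc far(1-3) far' walks v])
    then show ?thesis using out[OF v] by simp
  qed
qed

lemma gather_outcome:
  assumes "2 \<le> l" "card V < N" "3 \<le> card V" "\<And>x K. x < card V ^ a \<Longrightarrow> K \<subseteq> {..<card V ^ a} \<times> {..<card V ^ a} \<Longrightarrow>
      prod_encode (x, set_encode (prod_encode ` K)) \<le> B"
    and "\<forall>v\<in>V. v < card V ^ a"
    and walks: "\<And>u v. u \<in> V \<Longrightarrow> v \<in> V \<Longrightarrow> (u, v) \<in> steps E D"
    and "v \<in> V"
  shows "outputs_by (verifier D a N B) G P l \<omega> (Suc D) v (edge_connected l G)"
proof -
  let ?I = "input_of G P l \<omega>" and ?n = "card V" and ?A = "verifier D a N B"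
  have I: "num_nodes (?I u) = ?n" "param (?I u) = l" "ident (?I u) = u" for u
    by (simp_all add: input_of_def V)
  have send: "send ?A (?I u) H i = gather_out (?I u) (gather_state (?I u) H)"
    if "u \<in> V" "gather_state (?I u) H \<subseteq> E" for u H i
  proof -
    have "gather_state (?I u) H \<subseteq> {..<?n ^ a} \<times> {..<?n ^ a}"
      using that(2) E_sub assms(5) by fastforce
    then have "length (gather_out (?I u) (gather_state (?I u) H)) \<le> B"
      using assms(4,5) that(1) by (simp add: gather_out_def I)
    then have "real (length (gather_out (?I u) (gather_state (?I u) H))) \<le> real B * 1" by simp
    also have "\<dots> \<le> real B * log 2 (real ?n)"
      using nbits_props(1)[OF assms(3)] by (intro mult_left_mono) auto
    finally show ?thesis using assms(2) by (simp add: verifier_def I Let_def)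
  qed
  have K: "gather_state (?I v) (history ?A G P l \<omega> (Suc D) v) = E"
    using gather_history[OF send walks assms(7)] by blast
  \<comment> \<open>A connected graph with several vertices has no isolated one, so the arcs
    determine the vertex set.\<close>
  have "V \<subseteq> fst ` E"
  proof
    fix x assume x: "x \<in> V"
    obtain y where y: "y \<in> V" "y \<noteq> x"
    proof -
      have "\<not> V \<subseteq> {x}" using assms(3) card_mono[of "{x}" V] by auto
      then show ?thesis using that by blast
    qed
    have "(x, y) \<in> E\<^sup>*" using walks[OF x y(1)] steps_subset_rtrancl by blast
    then show "x \<in> fst ` E" using y(2) by (cases rule: converse_rtranclE) force+
  qed
  then have G: "\<lparr>pverts = fst ` E, parcs = E\<rparr> = G" using E_sub V E by (cases G) auto
  have "verdict ?A (?I v) H = (if length H = Suc D then Some (edge_connected l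
      \<lparr>pverts = fst ` gather_state (?I v) H, parcs = gather_state (?I v) H\<rparr>) else None)" for H
    using assms(1,2) by (simp add: verifier_def I Let_def)
  from outputs_byI[OF this] show ?thesis unfolding K G .
qed

text \<open>Which promise holds is a property of \<open>G\<close> and not random. In each case a
  single event \<open>Q\<close> about the trial coins covers all failures.\<close>

lemma prob_flood_verifies:
  assumes "pair_graph G" "2 \<le> l" "N \<le> card V" "3 \<le> card V" "\<forall>v\<in>V. v < card V ^ a" "2 + 2 * a \<le> B"
    and walks: "\<And>u v. u \<in> V \<Longrightarrow> v \<in> V \<Longrightarrow> (u, v) \<in> steps E D"
    and large: "trial_factor * (1 + D) * nbits (card V) \<le> 2 ^ nbits (card V)"
  defines "A \<equiv> verifier D a N B" and "T \<equiv> trials (card V) * Suc (radius D (card V) l) + D"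
  shows "measure_pmf.prob (coin_pmf A G l) {\<omega>. verifies_edge_connectivity A G P l \<omega> T} \<ge> 1 - 1 / real (card V)"
proof -
  let ?n = "card V" and ?p = "1 / 2 ^ lexp l :: real"
  let ?R = "levels ?n" and ?J = "trials ?n"
  let ?X = "E \<times> {..<?J} \<times> {..?R}"
  have finE: "finite E" using E_sub finite_V by (auto intro: finite_subset)
  have finX: "finite ?X" using finE by auto
  have p: "0 \<le> ?p" "?p \<le> 1" by auto
  have coins: "num_coins A ?n l = num_blocks ?n * lexp l" by (simp add: A_def verifier_def)
  note outcome = flood_outcome[OF assms(2-6) walks, folded A_def T_def]
  have good: "1 - 1 / real ?n \<le> measure_pmf.prob (coin_pmf A G l) {\<omega>. verifies_edge_connectivity A G P l \<omega> T}"
    if bad: "expect ?p ?X (\<lambda>S. of_bool (Q S)) \<le> 1 / real ?n"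
      and Q: "\<And>\<omega>. \<not> Q (trial_coins l \<omega>) \<Longrightarrow> verifies_edge_connectivity A G P l \<omega> T" for Q
  proof -
    have "1 - 1 / real ?n \<le> expect ?p ?X (\<lambda>S. 1 - of_bool (Q S))"
      using bad finX by (simp add: expect_diff)
    also have "\<dots> = expect ?p ?X (\<lambda>S. of_bool (\<not> Q S))" by (simp only: of_bool_not_iff)
    also have "\<dots> = measure_pmf.prob (coin_pmf A G l) {\<omega>. \<not> Q (trial_coins l \<omega>)}"
      using prob_trial_coins[OF coins, where Q = "\<lambda>S. \<not> Q S"] by simp
    also have "\<dots> \<le> measure_pmf.prob (coin_pmf A G l) {\<omega>. verifies_edge_connectivity A G P l \<omega> T}"
      using Q by (intro measure_pmf.finite_measure_mono) auto
    finally show ?thesis .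
  qed
  \<comment> \<open>Strictness makes the promises exclude each other, since \<open>l\<close>-edge
    connectivity forces a connectivity of at least \<open>l\<close>, above
    \<open>l / log 2 n\<close>.\<close>
  have lg: "1 < log 2 (real ?n)"
  proof -
    have "log 2 2 < log 2 (real ?n)" using assms(4) by (subst log_less_cancel_iff) auto
    then show ?thesis by simp
  qed
  consider "edge_connected l G" | "real (edge_connectivity G) \<le> real l / log 2 (real ?n)"
    | "\<not> edge_connected l G" "\<not> real (edge_connectivity G) \<le> real l / log 2 (real ?n)" by blast
  then show ?thesis
  proof cases
    case 1
    have "real l \<le> real (edge_connectivity G)" using edge_connected_le_connectivity[OF assms(1) 1] by simp
    moreover have "real l / log 2 (real ?n) < real l" using lg assms(2) by (simp add: field_simps)
    ultimately have high: "\<not> real (edge_connectivity G) \<le> real l / log 2 (real ?n)" by linarith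
    let ?far = "\<lambda>Q. \<not> (\<forall>x\<in>V. \<forall>y\<in>V. (x, y) \<in> steps Q (radius D ?n l))"
    show ?thesis
    proof (rule good[where Q = "\<lambda>S. \<exists>j<?J. ?far (trial_graph j S)"])
      have half: "(1 - ?p) ^ l \<le> 1 / 2"
      proof -
        have "(1 - ?p) ^ l \<le> (1 - ?p) ^ (2 ^ lexp l)"
          using p lexp_props(2)[OF assms(2)] by (intro power_decreasing) auto
        then show ?thesis using pow_sample_le_half[of "lexp l"] by linarith
      qed
      have "V \<noteq> {}" using assms(4) by auto
      have "expect ?p (E \<times> {..?R}) (\<lambda>S. of_bool (?far (fst ` S \<union> (fst ` S)\<inverse>))) \<le>
          (3 / 4) ^ ?R * real ?n + real D * (real ?n * (1 - ?p) ^ walk_bound ?n l)"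
        unfolding radius_def
        by (rule expect_sampled_diameter[OF finite_V E_sub sym_E \<open>V \<noteq> {}\<close> p half walks])
          (use edge_connected_cut[OF assms(1) 1] in \<open>auto simp: V E\<close>)
      from expect_some_trial[OF finE p this, of ?J]
      show "expect ?p ?X (\<lambda>S. of_bool (\<exists>j<?J. ?far (trial_graph j S))) \<le> 1 / real ?n"
        using failure_bound[OF assms(4,2) large] by linarith
      show "verifies_edge_connectivity A G P l \<omega> T"
        if "\<not> (\<exists>j<?J. ?far (trial_graph j (trial_coins l \<omega>)))" for \<omega>
      proof -
        have "outputs_by A G P l \<omega> T v True" if "v \<in> V" for v
          by (rule outcome(2)) (use \<open>\<not> (\<exists>j<?J. ?far (trial_graph j (trial_coins l \<omega>)))\<close> that in blast)+
        then show ?thesis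
          using high by (auto simp: verifies_edge_connectivity_def V)
      qed
    qed
  next
    case 2
    have not_conn: "\<not> edge_connected l G"
    proof
      assume "edge_connected l G"
      then have "real l \<le> real (edge_connectivity G)" using edge_connected_le_connectivity[OF assms(1)] by simp
      moreover have "real l / log 2 (real ?n) < real l" using lg assms(2) by (simp add: field_simps)
      ultimately show False using 2 by linarith
    qed
    have "2 \<le> card (pverts G)" using assms(4) by (simp add: V)
    from edge_connectivity_witness[OF assms(1) this] obtain F where F: "F \<subseteq> uedges G"
      "card F = edge_connectivity G" "\<not> Digraph_Component.connected (with_proj (delete_uedges G F))" .
    let ?F = "{(u, v) \<in> E. {u, v} \<in> F}"
    have "V \<noteq> {}" using assms(4) by auto
    then obtain x y where xy: "x \<in> V" "y \<in> V" "(x, y) \<notin> {(u, v) \<in> E. {u, v} \<notin> F}\<^sup>*"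
      using F(3) unfolding connected_delete_uedges_iff[OF assms(1)] V E by blast
    show ?thesis
    proof (rule good[where Q = "\<lambda>S. \<forall>j<?J. S \<inter> ?F \<times> {j} \<times> {..?R} \<noteq> {}"])
      have "card ?F \<le> 2 * edge_connectivity G"
        using card_cut_arcs[OF assms(1) F(1)] F(2) by (simp add: E)
      then show "expect ?p ?X (\<lambda>S. of_bool (\<forall>j<?J. S \<inter> ?F \<times> {j} \<times> {..?R} \<noteq> {})) \<le> 1 / real ?n"
        using detection_bound[OF assms(4,2) 2] by (subst expect_no_trial_avoids[OF finE]) auto
      show "verifies_edge_connectivity A G P l \<omega> T"
        if miss: "\<not> (\<forall>j<?J. trial_coins l \<omega> \<inter> ?F \<times> {j} \<times> {..?R} \<noteq> {})" for \<omega>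
      proof -
        obtain j where j: "j < ?J" "trial_coins l \<omega> \<inter> ?F \<times> {j} \<times> {..?R} = {}" using miss by blast
        have "trial_graph j (trial_coins l \<omega>) \<subseteq> {(u, v) \<in> E. {u, v} \<notin> F}"
        proof -
          have "{u, v} \<notin> F" if "(u, v) \<in> E" "r \<le> ?R" "((u, v), j, r) \<in> trial_coins l \<omega>" for u v r
            using j(2) that by blast
          then show ?thesis using symD[OF sym_E] by (auto simp: insert_commute)
        qed
        then have "(x, y) \<notin> (trial_graph j (trial_coins l \<omega>))\<^sup>*" using xy(3) rtrancl_mono by blast
        then have "outputs_by A G P l \<omega> T v False" if "v \<in> V" for v
          using outcome(3)[OF _ _ j(1) xy(1,2)] that by blast
        then show ?thesis
          using not_conn by (auto simp: verifies_edge_connectivity_def V)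
      qed
    qed
  next
    case 3
    \<comment> \<open>Without a promise only termination is required, and that is certain.\<close>
    show ?thesis
    proof (rule good[where Q = "\<lambda>_. False"])
      show "expect ?p ?X (\<lambda>S. of_bool False) \<le> 1 / real ?n" using finX by simp
      show "verifies_edge_connectivity A G P l \<omega> T" for \<omega>
        using 3 outcome(1)[of \<omega>] by (auto simp: verifies_edge_connectivity_def V)
    qed
  qed
qed

end

text \<open>Justifies the constant answer YES for \<open>l \<le> 1\<close>: then
  \<open>l / log 2 n\<close> is below 1, so the NO promise cannot hold.\<close>

lemma edge_connectivity_pos:
  assumes "pair_graph G" "2 \<le> card (pverts G)"
    and walks: "\<And>u v. u \<in> pverts G \<Longrightarrow> v \<in> pverts G \<Longrightarrow> (u, v) \<in> steps (parcs G) D"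
  shows "0 < edge_connectivity G"
proof (rule ccontr)
  assume "\<not> 0 < edge_connectivity G"
  from edge_connectivity_witness[OF assms(1,2)] obtain F where F: "F \<subseteq> uedges G"
    "card F = edge_connectivity G" "\<not> Digraph_Component.connected (with_proj (delete_uedges G F))" .
  have "finite F" using F(1) finite_uedges[OF assms(1)] by (rule finite_subset)
  then have "F = {}" using F(2) \<open>\<not> 0 < edge_connectivity G\<close> by simp
  then have arcs: "{(u, v) \<in> parcs G. {u, v} \<notin> F} = parcs G" by auto
  have "pverts G \<noteq> {}" using assms(2) by auto
  moreover have "(u, v) \<in> (parcs G)\<^sup>*" if "u \<in> pverts G" "v \<in> pverts G" for u v
    using walks[OF that] steps_subset_rtrancl by blast
  ultimately have "Digraph_Component.connected (with_proj (delete_uedges G F))"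
    unfolding connected_delete_uedges_iff[OF assms(1)] arcs by blast
  then show False using F(3) by simp
qed

theorem theorem1p5:
  fixes D a :: nat
  shows "\<exists>(A :: congest_algorithm) (B :: nat) (p :: real poly) (c :: nat).
    c \<ge> 1 \<and> congest_bandwidth A B \<and>
    (\<forall>(G :: nat pair_pre_digraph) (P :: nat \<Rightarrow> nat list) (l :: nat) (n :: nat).
       pair_graph G \<and> card (pverts G) = n \<and> n \<ge> 3 \<and>
       graph_diameter G \<le> ereal (real D) \<and>
       (\<forall>v \<in> pverts G. v < n ^ a) \<and> port_numbering G P \<longrightarrow>
       (\<exists>T :: nat. real T \<le> poly p (real l * log 2 (real n)) \<and>
          measure_pmf.prob (coin_pmf A G l) {\<omega>. verifies_edge_connectivity A G P l \<omega> T}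
            \<ge> 1 - 1 / real n ^ c))"
proof -
  \<comment> \<open>For \<open>b \<ge> b0\<close> the product
    \<open>trial_factor * (1 + D) * b\<close> is at most \<open>b * b\<close>; the summand 4 is for
    \<open>square_le_two_power\<close>.\<close>
  define b0 where "b0 = trial_factor * (1 + D) + 4"
  define N :: nat where "N = 2 ^ b0"
  have large: "trial_factor * (1 + D) * nbits n \<le> 2 ^ nbits n" if "N \<le> n" "3 \<le> n" for n
  proof -
    have "(2::nat) ^ b0 \<le> n" using that(1) by (simp add: N_def)
    also have "\<dots> \<le> 2 ^ nbits n" by (rule nbits_props(2)[OF that(2)])
    finally have b0: "b0 \<le> nbits n" by simp
    then have "trial_factor * (1 + D) * nbits n \<le> nbits n * nbits n"
      by (intro mult_le_mono1) (simp add: b0_def)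
    also have "\<dots> \<le> 2 ^ nbits n" using b0 by (intro square_le_two_power) (simp add: b0_def)
    finally show ?thesis .
  qed
  \<comment> \<open>An upper set for the lengths of gathering messages when \<open>n < N\<close>; it
    is finite, so a constant \<open>B\<close> can dominate it.\<close>
  define codes where "codes = (\<Union>n<N. (\<lambda>(x, K). prod_encode (x, set_encode (prod_encode ` K))) `
    ({..<n ^ a} \<times> Pow ({..<n ^ a} \<times> {..<n ^ a})))"
  define B where "B = 2 + 2 * a + Max (insert 0 codes)"
  have "finite codes" unfolding codes_def by auto
  then have code_le: "prod_encode (x, set_encode (prod_encode ` K)) \<le> B"
    if "n < N" "x < n ^ a" "K \<subseteq> {..<n ^ a} \<times> {..<n ^ a}" for n x K
  proof -
    have "prod_encode (x, set_encode (prod_encode ` K)) \<in> codes"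
      unfolding codes_def using that by (intro UN_I[of n] image_eqI[of _ _ "(x, K)"]) auto
    then have "prod_encode (x, set_encode (prod_encode ` K)) \<le> Max (insert 0 codes)"
      using \<open>finite codes\<close> by (intro Max_ge) auto
    then show ?thesis by (simp add: B_def)
  qed
  \<comment> \<open>The summand 1 lets the same polynomial cover the \<open>Suc D\<close> rounds of
    gathering.\<close>
  define c0 where "c0 = 2 * real trial_factor * 15 ^ D + real D + 1"
  have c0: "2 * real trial_factor * 15 ^ D + real D \<le> c0" "real (Suc D) \<le> c0" "0 \<le> c0"
    by (simp_all add: c0_def)
  let ?A = "verifier D a N B" and ?p = "monom c0 (Suc D)"
  have "\<exists>T :: nat. real T \<le> poly ?p (real l * log 2 (real n)) \<and>
      measure_pmf.prob (coin_pmf ?A G l) {\<omega>. verifies_edge_connectivity ?A G P l \<omega> T} \<ge> 1 - 1 / real n ^ 1"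
    if G: "pair_graph G" and n: "card (pverts G) = n" "n \<ge> 3" and diam: "graph_diameter G \<le> ereal (real D)"
      and ids: "\<forall>v \<in> pverts G. v < n ^ a" and ports: "port_numbering G P" for G P l n
  proof -
    interpret network G P "pverts G" "parcs G"
      using pair_graph_props[OF G] ports by unfold_locales auto
    have walks: "(u, v) \<in> steps (parcs G) D" if "u \<in> pverts G" "v \<in> pverts G" for u v
      using diameter_steps[OF G diam that] .
    have pr: "poly ?p x = c0 * x ^ Suc D" for x by (simp add: poly_monom)
    have sure: "1 - 1 / real n ^ 1 \<le> measure_pmf.prob (coin_pmf ?A G l) {\<omega>. verifies_edge_connectivity ?A G P l \<omega> T}"
      if "\<And>\<omega>. verifies_edge_connectivity ?A G P l \<omega> T" for T
      using that by simp
    have low: "0 < edge_connectivity G" using edge_connectivity_pos[OF G _ walks] n by simp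
    have lg: "1 < log 2 (real n)"
    proof -
      have "log 2 2 < log 2 (real n)" using n(2) by (subst log_less_cancel_iff) auto
      then show ?thesis by simp
    qed
    consider "l \<le> 1" | "2 \<le> l" "n < N" | "2 \<le> l" "N \<le> n" by linarith
    then show ?thesis
    proof cases
      case 1
      have out: "outputs_by ?A G P l \<omega> 0 v True" for \<omega> v
        using 1 by (simp add: outputs_by_def verifier_def input_of_def)
      have "real l / log 2 (real n) < 1" using 1 lg by (simp add: field_simps)
      then have "\<not> real (edge_connectivity G) \<le> real l / log 2 (real (card (pverts G)))"
        using low n(1) by simp
      then have "verifies_edge_connectivity ?A G P l \<omega> 0" for \<omega>
        using out unfolding verifies_edge_connectivity_def by blast
      moreover have "real 0 \<le> poly ?p (real l * log 2 (real n))"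
        unfolding pr using c0(3) lg by simp
      ultimately show ?thesis using sure[of 0] by blast
    next
      case 2
      have out: "outputs_by ?A G P l \<omega> (Suc D) v (edge_connected l G)" if "v \<in> pverts G" for \<omega> v
        using gather_outcome[of l N a B D v, OF 2(1) _ _ _ _ walks that] 2(2) n ids code_le[OF 2(2)] by simp
      have "\<not> edge_connected l G" if "real (edge_connectivity G) \<le> real l / log 2 (real (card (pverts G)))"
      proof
        assume "edge_connected l G"
        then have "real l \<le> real (edge_connectivity G)" using edge_connected_le_connectivity[OF G] by simp
        moreover have "real l / log 2 (real n) < real l" using lg 2 by (simp add: field_simps)
        ultimately show False using that n(1) by simp
      qed
      then have "verifies_edge_connectivity ?A G P l \<omega> (Suc D)" for \<omega>
        using out[of _ \<omega>] unfolding verifies_edge_connectivity_def by auto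
      moreover have "real (Suc D) \<le> poly ?p (real l * log 2 (real n))"
      proof -
        have "real (Suc D) * 1 \<le> c0 * (real l * log 2 (real n)) ^ Suc D"
          using c0 round_bound(2)[OF n(2) 2(1)] by (intro mult_mono one_le_power) auto
        then show ?thesis unfolding pr by simp
      qed
      ultimately show ?thesis using sure[of "Suc D"] by blast
    next
      case 3
      let ?T = "trials n * Suc (radius D n l) + D"
      have "real ?T \<le> (2 * real trial_factor * 15 ^ D + real D) * (real l * log 2 (real n)) ^ Suc D"
        by (rule round_bound(1)[OF n(2) 3(1)])
      also have "\<dots> \<le> c0 * (real l * log 2 (real n)) ^ Suc D"
        using c0(1) round_bound(2)[OF n(2) 3(1)] by (intro mult_right_mono) auto
      finally have "real ?T \<le> poly ?p (real l * log 2 (real n))" unfolding pr .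
      moreover have "1 - 1 / real n ^ 1 \<le>
          measure_pmf.prob (coin_pmf ?A G l) {\<omega>. verifies_edge_connectivity ?A G P l \<omega> ?T}"
        using prob_flood_verifies[of l N a B D, OF G 3(1) _ _ _ _ walks] 3(2) n ids large[OF 3(2) n(2)]
        by (simp add: B_def)
      ultimately show ?thesis by blast
    qed
  qed
  then have main: "\<forall>G P l n. pair_graph G \<and> card (pverts G) = n \<and> n \<ge> 3 \<and>
       graph_diameter G \<le> ereal (real D) \<and>
       (\<forall>v \<in> pverts G. v < n ^ a) \<and> port_numbering G P \<longrightarrow>
       (\<exists>T :: nat. real T \<le> poly ?p (real l * log 2 (real n)) \<and>
          measure_pmf.prob (coin_pmf ?A G l) {\<omega>. verifies_edge_connectivity ?A G P l \<omega> T}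
            \<ge> 1 - 1 / real n ^ 1)" by blast
  show ?thesis
    by (intro exI[of _ ?A] exI[of _ B] exI[of _ ?p] exI[of _ "1::nat"] conjI order_refl
        congest_bandwidth_verifier main)
qed

end
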